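(* Let $J:\mathbb{N}_0\to\mathbb{R}\cup\{\infty\}$ be an interaction potential with $J(0)=\infty$ and $J(k)\in\mathbb{R}$ for $k\ge1$, and let $y_0=0$, $y_k=e^{-J(k)}$ for $k\geq 1$. Assume that the sequence $\{y_n/y_{n+1}\}_{n\ge0}$ is bounded. Let $$F(u)=\sum_{k=0}^\infty u^ky_{k+1},\qquad u\in(0,u_c),$$ where $u_c$ is the radius of convergence of this series, assumed to satisfy $u_c>0$. Let $r(u)=u\frac{d}{du}\ln F(u)$ for $u\in(0,u_c)$, let $r(u_c)=\lim_{u\nearrow u_c}r(u)\in(0,\infty]$, and let $\phi$ be the inverse function of $r$ (extended by $\phi(r(u_c))=u_c$ if $r(u_c)<\infty$). Put $$\rho_c=\frac{1}{1+r(u_c)}\in[0,1)$$ (with $\rho_c=0$ if $r(u_c)=\infty$). Let $w>0$ and consider the totally asymmetric headway exclusion process (TAHEP) with jump rates $w_0=0$, $w_n=w\,e^{J(n+1)-J(n)}$, $n\ge1$. Then the current-density relation $j^+(\rho)=\lim_{L\to\infty}j^+_{L,\lfloor\rho L\rfloor}$, $\rho\in(0,1)$, is given by $$j^+(\rho)=\begin{cases}w\,\rho\,\phi(1/\rho-1), & \rho\in[\rho_c,1),\ \rho>0,\\ w\,\rho\,\phi(1/\rho_c-1), & \rho\in(0,\rho_c).\end{cases}$$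
   Context: $\mathbb{N}_0=\{0,1,2,\dots\}$, $\mathbb{T}_L=\mathbb{Z}/L\mathbb{Z}$ with sites $0,\dots,L-1$ (indices modulo $L$). Configurations: $\boldsymbol\eta=(\eta_0,\dots,\eta_{L-1})\in\{0,1\}^L$; $\Omega^{can}_{L,N}=\{\boldsymbol\eta\in\{0,1\}^L:\sum_x\eta_x=N\}$. The headway of a particle is the number of empty sites between it and the next particle to its right on the torus; if there is a single particle, its headway is $L-1$. Headway indicator: $h_{x,n}(\boldsymbol\eta)=1$ if $\eta_x=1$ and the headway of the particle at $x$ is $n$, and $0$ otherwise. TAHEP with $N$ particles on $\mathbb{T}_L$: the continuous-time Markov chain on $\Omega^{can}_{L,N}$ with generator $(\mathcal{L}f)(\boldsymbol\eta)=\sum_{x\in\mathbb{T}_L}c_x(\boldsymbol\eta)[f(\boldsymbol\eta^{x,x+1})-f(\boldsymbol\eta)]$, where $c_x(\boldsymbol\eta)=\sum_{n=0}^{L-1}w_nh_{x,n}(\boldsymbol\eta)$ and $\boldsymbol\eta^{x,y}$ is $\boldsymbol\eta$ with the occupation numbers at $x,y$ exchanged. Canonical headway measure: $\mu^{can}_{L,N}(\boldsymbol\eta)=\pi_L(\boldsymbol\eta)/Z^{can}_{L,N}$ on $\Omega^{can}_{L,N}$, with $\pi_L(\boldsymbol\eta)=\prod_{x=0}^{L-1}\prod_{n=0}^{L-1}y_{n+1}^{h_{x,n}(\boldsymbol\eta)}$ and $Z^{can}_{L,N}=\sum_{\boldsymbol\eta\in\Omega^{can}_{L,N}}\pi_L(\boldsymbol\eta)$.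 It is the invariant measure of this TAHEP. The stationary current is the expectation under $\mu^{can}_{L,N}$ of the instantaneous current $j^+_x(\boldsymbol\eta)=\sum_{n=1}^{L-1}w_nh_{x,n}(\boldsymbol\eta)$, which is independent of $x$: $j^+_{L,N}=\sum_{n=1}^{L-1}w_n\,\mathbb{E}_{\mu^{can}_{L,N}}[h_{0,n}]$. *)

theory Defs
  imports "HOL-Analysis.Analysis"
begin

text \<open>
  The torus \<open>\<int>/L\<int>\<close> is \<open>{..<L}\<close> with arithmetic modulo \<open>L\<close>, and a configuration is an
  (extensional) map \<open>{..<L} \<rightarrow> {0, 1}\<close>.
\<close>

definition configs_can :: "nat \<Rightarrow> nat \<Rightarrow> (nat \<Rightarrow> nat) set" where
  "configs_can L N = {\<eta> \<in> {..<L} \<rightarrow>\<^sub>E {0, 1}. (\<Sum>x<L. \<eta> x) = N}"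

text \<open>
  Number of empty sites following a particle at \<open>x\<close>. For a single particle the search
  returns to \<open>x\<close> itself, which gives the conventional value \<open>L - 1\<close>.
\<close>

definition headway :: "nat \<Rightarrow> (nat \<Rightarrow> nat) \<Rightarrow> nat \<Rightarrow> nat" where
  "headway L \<eta> x = (LEAST k. \<eta> ((x + k + 1) mod L) = 1)"

definition headway_ind :: "nat \<Rightarrow> nat \<Rightarrow> nat \<Rightarrow> (nat \<Rightarrow> nat) \<Rightarrow> nat" where
  "headway_ind L x n \<eta> = (if \<eta> x = 1 \<and> headway L \<eta> x = n then 1 else 0)"

subsection \<open>The process\<close>

definition exchange :: "(nat \<Rightarrow> nat) \<Rightarrow> nat \<Rightarrow> nat \<Rightarrow> (nat \<Rightarrow> nat)" where
  "exchange \<eta> x y = \<eta>(x := \<eta> y, y := \<eta> x)"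

definition exit_rate :: "(nat \<Rightarrow> real) \<Rightarrow> nat \<Rightarrow> nat \<Rightarrow> (nat \<Rightarrow> nat) \<Rightarrow> real" where
  "exit_rate w L x \<eta> = (\<Sum>n<L. w n * headway_ind L x n \<eta>)"

definition tahep_generator ::
  "(nat \<Rightarrow> real) \<Rightarrow> nat \<Rightarrow> ((nat \<Rightarrow> nat) \<Rightarrow> real) \<Rightarrow> (nat \<Rightarrow> nat) \<Rightarrow> real" where
  "tahep_generator w L f \<eta> =
     (\<Sum>x<L. exit_rate w L x \<eta> * (f (exchange \<eta> x ((x + 1) mod L)) - f \<eta>))"

subsection \<open>The canonical headway measure and the stationary current\<close>

text \<open>Here \<open>y\<close> is the sequence of weights and \<open>w\<close> the sequence of jump rates.\<close>

definition headway_weight :: "(nat \<Rightarrow> real) \<Rightarrow> nat \<Rightarrow> (nat \<Rightarrow> nat) \<Rightarrow> real" where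
  "headway_weight y L \<eta> = (\<Prod>x<L. \<Prod>n<L. y (n + 1) ^ headway_ind L x n \<eta>)"

definition partition_can :: "(nat \<Rightarrow> real) \<Rightarrow> nat \<Rightarrow> nat \<Rightarrow> real" where
  "partition_can y L N = (\<Sum>\<eta>\<in>configs_can L N. headway_weight y L \<eta>)"

definition headway_measure_can :: "(nat \<Rightarrow> real) \<Rightarrow> nat \<Rightarrow> nat \<Rightarrow> (nat \<Rightarrow> nat) \<Rightarrow> real" where
  "headway_measure_can y L N \<eta> = headway_weight y L \<eta> / partition_can y L N"

definition expectation_can ::
  "(nat \<Rightarrow> real) \<Rightarrow> nat \<Rightarrow> nat \<Rightarrow> ((nat \<Rightarrow> nat) \<Rightarrow> real) \<Rightarrow> real" where
  "expectation_can y L N f = (\<Sum>\<eta>\<in>configs_can L N. headway_measure_can y L N \<eta> * f \<eta>)"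

definition instantaneous_current :: "(nat \<Rightarrow> real) \<Rightarrow> nat \<Rightarrow> nat \<Rightarrow> (nat \<Rightarrow> nat) \<Rightarrow> real" where
  "instantaneous_current w L x \<eta> = (\<Sum>n=1..L-1. w n * headway_ind L x n \<eta>)"

definition stationary_current :: "(nat \<Rightarrow> real) \<Rightarrow> (nat \<Rightarrow> real) \<Rightarrow> nat \<Rightarrow> nat \<Rightarrow> real" where
  "stationary_current w y L N = expectation_can y L N (instantaneous_current w L 0)"

subsection \<open>Interaction potential and generating function\<close>

definition pot_weight :: "(nat \<Rightarrow> ereal) \<Rightarrow> nat \<Rightarrow> real" where
  "pot_weight J k = (if k = 0 then 0 else exp (- real_of_ereal (J k)))"

definition tahep_rate :: "real \<Rightarrow> (nat \<Rightarrow> ereal) \<Rightarrow> nat \<Rightarrow> real" where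
  "tahep_rate w J n = (if n = 0 then 0 else w * exp (real_of_ereal (J (n + 1) - J n)))"

definition gen_fun :: "(nat \<Rightarrow> real) \<Rightarrow> real \<Rightarrow> real" where
  "gen_fun y u = (\<Sum>k. u ^ k * y (k + 1))"

text \<open>
  The radius of convergence, as a real number: it is finite whenever the ratios
  \<open>y n / y (n + 1)\<close> are bounded and \<open>y k > 0\<close> for \<open>k \<ge> 1\<close>.
\<close>

definition u_crit :: "(nat \<Rightarrow> real) \<Rightarrow> real" where
  "u_crit y = real_of_ereal (conv_radius (\<lambda>k. y (k + 1)))"

definition mean_headway :: "(nat \<Rightarrow> real) \<Rightarrow> real \<Rightarrow> real" where
  "mean_headway y u = u * deriv (\<lambda>v. ln (gen_fun y v)) u"

definition mean_headway_crit :: "(nat \<Rightarrow> real) \<Rightarrow> ereal" where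
  "mean_headway_crit y = Lim (at_left (u_crit y)) (\<lambda>u. ereal (mean_headway y u))"

definition fugacity :: "(nat \<Rightarrow> real) \<Rightarrow> real \<Rightarrow> real" where
  "fugacity y t =
     (if ereal t = mean_headway_crit y then u_crit y
      else the_inv_into {0<..<u_crit y} (mean_headway y) t)"

definition rho_crit :: "(nat \<Rightarrow> real) \<Rightarrow> real" where
  "rho_crit y =
     (if mean_headway_crit y = \<infinity> then 0
      else 1 / (1 + real_of_ereal (mean_headway_crit y)))"

subsection \<open>The canonical headway measure is invariant\<close>

text \<open>
  In a configuration \<open>\<zeta>\<close>, the flux into \<open>\<zeta>\<close> through the bond \<open>(x, x + 1)\<close> balances the flux out
  of \<open>\<zeta>\<close> caused by the jump of the particle preceding \<open>x\<close>.
\<close>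

lemma shift_mod_inj: "(p + i) mod L = (p + j) mod L \<Longrightarrow> i < L \<Longrightarrow> j < L \<Longrightarrow> i = (j::nat)"
proof (induction i j rule: linorder_wlog)
  case (le a b)
  then have "L dvd (p + b) - (p + a)" by (metis add_le_mono1 add.commute mod_eq_dvd_iff_nat)
  then show ?case using le by (auto dest: dvd_imp_le)
qed simp

lemma bij_shift:
  assumes "L > 0" shows "bij_betw (\<lambda>c. (p + c) mod L) {..<L} {..<L::nat}"
proof -
  have inj: "inj_on (\<lambda>c. (p + c) mod L) {..<L}"
    by (rule inj_onI) (erule shift_mod_inj; simp)
  have "(\<lambda>c. (p + c) mod L) ` {..<L} \<subseteq> {..<L}" using assms by auto
  then have "(\<lambda>c. (p + c) mod L) ` {..<L} = {..<L}"
    by (rule card_subset_eq[OF finite_lessThan]) (rule card_image[OF inj])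
  with inj show ?thesis unfolding bij_betw_def by blast
qed

definition gap :: "(nat \<Rightarrow> nat) \<Rightarrow> nat \<Rightarrow> nat" where
  "gap g c = (LEAST k. g (c + k + 1) = 1)"

lemma gap_eqI:
  assumes "g (c + k + 1) = 1" and "\<And>j. c < j \<Longrightarrow> j \<le> c + k \<Longrightarrow> g j \<noteq> 1"
  shows "gap g c = k"
  unfolding gap_def
proof (rule Least_equality)
  fix l assume l: "g (c + l + 1) = 1"
  show "k \<le> l"
  proof (rule ccontr)
    assume "\<not> k \<le> l"
    then have "c + l + 1 \<le> c + k" by simp
    then show False using assms(2)[of "c + l + 1"] l by simp
  qed
qed (rule assms(1))

lemma gap_props:
  assumes "g d = 1" "c < d"
  shows "g (c + gap g c + 1) = 1" "c + gap g c + 1 \<le> d"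
    and "c < j \<Longrightarrow> j \<le> c + gap g c \<Longrightarrow> g j \<noteq> 1"
proof -
  have 1: "g (c + (d - c - 1) + 1) = 1" using assms by simp
  show "g (c + gap g c + 1) = 1" unfolding gap_def by (rule LeastI) (rule 1)
  have "gap g c \<le> d - c - 1" unfolding gap_def by (rule Least_le) (rule 1)
  then show "c + gap g c + 1 \<le> d" using assms by simp
  show "g j \<noteq> 1" if "c < j" "j \<le> c + gap g c"
  proof
    assume "g j = 1"
    then have "gap g c \<le> j - c - 1" unfolding gap_def using that by (intro Least_le) simp
    then show False using that by linarith
  qed
qed

lemma headway_shift:
  "headway L \<eta> ((p + c) mod L) = gap (\<lambda>i. \<eta> ((p + i) mod L)) c"
proof -
  have "((p + c) mod L + k + 1) mod L = (p + (c + k + 1)) mod L" for k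
    by (metis mod_add_left_eq add.assoc)
  then show ?thesis unfolding headway_def gap_def by simp
qed

lemma headway_0: "headway L \<eta> p = gap (\<lambda>i. \<eta> ((p + i) mod L)) 0"
  unfolding headway_def gap_def by (simp add: add.assoc)

lemma headway_less: assumes "p < L" "\<eta> p = 1" shows "headway L \<eta> p < L"
  using gap_props(2)[of "\<lambda>i. \<eta> ((p + i) mod L)" L 0] assms unfolding headway_0 by simp

lemma exit_rate_eq:
  assumes "p < L" shows "exit_rate w L p \<eta> = (if \<eta> p = 1 then w (headway L \<eta> p) else 0)"
proof (cases "\<eta> p = 1")
  case True
  have "exit_rate w L p \<eta> = (\<Sum>n<L. if headway L \<eta> p = n then w n else 0)"
    unfolding exit_rate_def headway_ind_def by (rule sum.cong) (auto simp: True)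
  then show ?thesis using headway_less[OF assms, of \<eta>] True by simp
qed (simp add: exit_rate_def headway_ind_def)

lemma headway_weight_eq:
  "headway_weight y L \<eta> = (\<Prod>x\<in>{x. x < L \<and> \<eta> x = 1}. y (headway L \<eta> x + 1))"
proof -
  have "headway_weight y L \<eta> = (\<Prod>x<L. if \<eta> x = 1 then y (headway L \<eta> x + 1) else 1)"
    unfolding headway_weight_def
  proof (rule prod.cong)
    fix x assume x: "x \<in> {..<L}"
    show "(\<Prod>n<L. y (n + 1) ^ headway_ind L x n \<eta>) = (if \<eta> x = 1 then y (headway L \<eta> x + 1) else 1)"
    proof (cases "\<eta> x = 1")
      case True
      have "(\<Prod>n<L. y (n + 1) ^ headway_ind L x n \<eta>) = (\<Prod>n<L. if headway L \<eta> x = n then y (n + 1) else 1)"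
        unfolding headway_ind_def by (rule prod.cong) (auto simp: True)
      then show ?thesis using headway_less[of x L \<eta>] True x by simp
    qed (simp add: headway_ind_def)
  qed simp
  then show ?thesis
    by (simp add: prod.If_cases Int_def lessThan_def)
qed

lemma headway_weight_shift:
  assumes "L > 0"
  shows "headway_weight y L \<eta> =
    (\<Prod>c\<in>{c. c < L \<and> \<eta> ((p + c) mod L) = 1}. y (gap (\<lambda>i. \<eta> ((p + i) mod L)) c + 1))"
proof -
  note B = bij_shift[OF assms, of p]
  have b: "bij_betw (\<lambda>c. (p + c) mod L) {c. c < L \<and> \<eta> ((p + c) mod L) = 1} {x. x < L \<and> \<eta> x = 1}"
    unfolding bij_betw_def
  proof (intro conjI inj_onI subset_antisym subsetI)
    fix x assume x: "x \<in> {x. x < L \<and> \<eta> x = 1}"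
    then obtain c where "c < L" "x = (p + c) mod L"
      using B unfolding bij_betw_def by blast
    with x show "x \<in> (\<lambda>c. (p + c) mod L) ` {c. c < L \<and> \<eta> ((p + c) mod L) = 1}" by blast
  next
    fix c d assume "c \<in> {c. c < L \<and> \<eta> ((p + c) mod L) = 1}" "d \<in> {c. c < L \<and> \<eta> ((p + c) mod L) = 1}"
      and "(p + c) mod L = (p + d) mod L"
    then show "c = d" using shift_mod_inj[of p c L d] by blast
  qed (use assms in auto)
  show ?thesis unfolding headway_weight_eq
    by (subst prod.reindex_bij_betw[OF b, symmetric]) (simp add: headway_shift)
qed

lemma jump_balance:
  fixes y w :: "nat \<Rightarrow> real"
  assumes pos: "\<And>k. k \<ge> 1 \<Longrightarrow> y k > 0" and w: "\<And>n. w n = v * y n / y (n + 1)"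
    and L: "2 \<le> L" and p: "p < L" "\<zeta> p = 1" and m: "headway L \<zeta> p = m" "m \<ge> 1"
    and x: "x = (p + m) mod L" 
  shows "headway_weight y L (exchange \<zeta> x ((x + 1) mod L)) * w (headway L (exchange \<zeta> x ((x + 1) mod L)) x)
     = headway_weight y L \<zeta> * w m"
proof -
  define s where "s = (x + 1) mod L"
  define \<eta> where "\<eta> = exchange \<zeta> x s"
  define g where "g = (\<lambda>i. \<zeta> ((p + i) mod L))"
  define g' where "g' = (\<lambda>i. \<eta> ((p + i) mod L))"
  have s: "s = (p + (m + 1)) mod L" unfolding s_def x by (simp add: mod_Suc_eq)
  have mg: "m = gap g 0" using m unfolding headway_0 g_def by simp
  have g0: "g 0 = 1" "g L = 1" using p by (simp_all add: g_def)
  note gp = gap_props[of g L 0, OF g0(2), folded mg]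
  have mL: "m < L" using gp(2) L by simp
  have gm1: "g (m + 1) = 1" using gp(1) L by simp
  have gm: "g j \<noteq> 1" if "0 < j" "j \<le> m" for j using gp(3)[of j] that L by simp
  have ne: "x \<noteq> s" using gm1 gm[of m] m(2) x s unfolding g_def by auto
  have \<eta>x: "\<eta> x = 1" "\<eta> s \<noteq> 1" using gm1 gm[of m] m(2) x s ne unfolding g_def \<eta>_def exchange_def by auto
  have g'm: "g' m = 1" "g' (m + 1) \<noteq> 1" using \<eta>x x s unfolding g'_def by auto
  have same: "g' i = g i" if "i < L" "i \<noteq> m" "m + 1 < L \<longrightarrow> i \<noteq> m + 1" "m + 1 = L \<longrightarrow> i \<noteq> 0" for i
  proof -
    have "(p + i) mod L \<noteq> x" using shift_mod_inj[of p i L m] that mL x by auto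
    moreover have "(p + i) mod L \<noteq> s"
    proof (cases "m + 1 < L")
      case True
      then show ?thesis using shift_mod_inj[of p i L "m + 1"] that s by auto
    next
      case False
      then have "m + 1 = L" using mL by simp
      then have "s = (p + 0) mod L" unfolding s by (metis add.right_neutral mod_add_self2)
      then show ?thesis using shift_mod_inj[of p i L 0] that \<open>m + 1 = L\<close> by auto
    qed
    ultimately show ?thesis unfolding g'_def g_def \<eta>_def exchange_def by simp
  qed
  have hx: "headway L \<eta> x = gap g' m" unfolding x headway_shift g'_def ..
  have W: "headway_weight y L \<zeta> = (\<Prod>c\<in>{c. c < L \<and> g c = 1}. y (gap g c + 1))"
    unfolding g_def using headway_weight_shift[of L y \<zeta> p] L by simp
  have W': "headway_weight y L \<eta> = (\<Prod>c\<in>{c. c < L \<and> g' c = 1}. y (gap g' c + 1))"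
    unfolding g'_def using headway_weight_shift[of L y \<eta> p] L by simp
  have "headway_weight y L \<eta> * w (gap g' m) = headway_weight y L \<zeta> * w m"
  proof (cases "m + 1 < L")
    case False
    then have mL1: "m + 1 = L" using mL by simp
    have P: "{c. c < L \<and> g c = 1} = {0}"
      using g0 gm L mL1 by (auto simp: neq0_conv[symmetric] simp del: neq0_conv) (metis Suc_eq_plus1 less_Suc_eq_le)
    have g'0: "g' 0 \<noteq> 1" using g'm(2) unfolding mL1 g'_def by simp
    have g'j: "g' j \<noteq> 1" if "j < m" for j
      using same[of j] gm[of j] that mL1 g'0 by (cases "j = 0") auto
    have P': "{c. c < L \<and> g' c = 1} = {m}"
      using g'm g'j mL1 by (auto) (metis Suc_lessI less_antisym)
    have per: "g' (i + L) = g' i" for i unfolding g'_def by (simp add: add.assoc[symmetric])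
    have "gap g' m = m"
    proof (rule gap_eqI)
      have "m + m + 1 = m + L" using mL1 by simp
      then show "g' (m + m + 1) = 1" using per[of m] g'm by metis
      fix j assume "m < j" "j \<le> m + m"
      then have "j = (j - L) + L" "j - L < m" using mL1 m by auto
      then show "g' j \<noteq> 1" using per[of "j - L"] g'j by metis
    qed
    then show ?thesis unfolding W W' P P' using mg by simp
  next
    case True
    define C where "C = {c. m + 2 \<le> c \<and> c < L \<and> g c = 1}"
    have eqC: "g' i = g i" if "m + 2 \<le> i" "i \<le> L" for i
    proof (cases "i < L")
      case True then show ?thesis using same[of i] that by simp
    next
      case False
      then have "i = L" using that by simp
      moreover have "g' 0 = g 0" using same[of 0] m(2) True by auto
      ultimately show ?thesis by (simp add: g'_def g_def)
    qed
    have finC: "finite C" unfolding C_def by simp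
    have P: "{c. c < L \<and> g c = 1} = insert 0 (insert (m + 1) C)"
    proof -
      have "c = 0 \<or> c = m + 1 \<or> m + 2 \<le> c" if "g c = 1" for c
        using gm[of c] that by fastforce
      then show ?thesis unfolding C_def using True g0(1) gm1 by auto
    qed
    have P': "{c. c < L \<and> g' c = 1} = insert 0 (insert m C)"
    proof -
      have dich: "c = 0 \<or> c = m \<or> m + 2 \<le> c" if "g' c = 1" for c
      proof (rule ccontr)
        assume a: "\<not> ?thesis"
        then have "c < m" using that g'm by (cases "c = m + 1") auto
        then show False using same[of c] gm[of c] a that True mL by auto
      qed
      have g'0: "g' 0 = 1" using same[of 0] g0 m(2) True by auto
      have in_C: "c \<in> C" if "m + 2 \<le> c" "c < L" "g' c = 1" for c
        using that eqC[of c] unfolding C_def by simp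
      have C_in: "c < L" "g' c = 1" if "c \<in> C" for c
        using that eqC[of c] unfolding C_def by auto
      show ?thesis
      proof (intro subset_antisym subsetI)
        fix c assume "c \<in> {c. c < L \<and> g' c = 1}"
        then have c: "c < L" "g' c = 1" by blast+
        from dich[OF c(2)] show "c \<in> insert 0 (insert m C)"
          using in_C[OF _ c] by blast
      next
        fix c assume "c \<in> insert 0 (insert m C)"
        then consider "c = 0" | "c = m" | "c \<in> C" by blast
        then have "c < L \<and> g' c = 1"
        proof cases
          case 1 with g'0 L show ?thesis by simp
        next
          case 2 with g'm(1) mL show ?thesis by simp
        next
          case 3 with C_in show ?thesis by blast
        qed
        then show "c \<in> {c. c < L \<and> g' c = 1}" by blast
      qed
    qed
    have h0: "gap g' 0 = m - 1"
    proof (rule gap_eqI)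
      show "g' (0 + (m - 1) + 1) = 1" using g'm m(2) by simp
      fix j assume "0 < j" "j \<le> 0 + (m - 1)"
      then show "g' j \<noteq> 1" using same[of j] gm[of j] mL True by auto
    qed
    have hC: "gap g' c = gap g c" if "m + 1 \<le> c" "c < L" for c
    proof (rule gap_eqI)
      note q = gap_props[of g L c, OF g0(2) that(2)]
      show "g' (c + gap g c + 1) = 1" using q(1,2) eqC[of "c + gap g c + 1"] that by simp
      fix j assume "c < j" "j \<le> c + gap g c"
      then show "g' j \<noteq> 1" using q(2) q(3)[of j] eqC[of j] that by simp
    qed
    have hm: "gap g' m = gap g (m + 1) + 1"
    proof (rule gap_eqI)
      note q = gap_props[of g L "m + 1", OF g0(2) True]
      show "g' (m + (gap g (m + 1) + 1) + 1) = 1"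
        using q(1,2) eqC[of "m + (gap g (m + 1) + 1) + 1"] by (simp add: ac_simps)
      fix j assume j: "m < j" "j \<le> m + (gap g (m + 1) + 1)"
      show "g' j \<noteq> 1"
      proof (cases "j = m + 1")
        case True then show ?thesis using g'm by simp
      next
        case False
        then show ?thesis using j q(2) q(3)[of j] eqC[of j] by simp
      qed
    qed
    have prodC: "(\<Prod>c\<in>C. y (gap g' c + 1)) = (\<Prod>c\<in>C. y (gap g c + 1))"
      by (rule prod.cong) (auto simp: C_def hC)
    have nin: "0 \<notin> insert (m + 1) C" "m + 1 \<notin> C" "0 \<notin> insert m C" "m \<notin> C"
      using m(2) unfolding C_def by auto
    define Q where "Q = (\<Prod>c\<in>C. y (gap g c + 1))"
    define a where "a = gap g (m + 1)"
    have 1: "headway_weight y L \<zeta> = y (m + 1) * (y (a + 1) * Q)"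
      unfolding W P Q_def a_def using nin finC mg by simp
    have 2: "headway_weight y L \<eta> = y m * (y (a + 2) * Q)"
      unfolding W' P' Q_def a_def using nin finC h0 hm prodC m(2) by simp
    have "y (m + 1) \<noteq> 0" "y (a + 2) \<noteq> 0" using pos[of "m + 1"] pos[of "a + 2"] by auto
    then show ?thesis unfolding 1 2 hm w a_def[symmetric] by simp
  qed
  then show ?thesis unfolding hx[symmetric] \<eta>_def s_def .
qed

lemma jump_bij:
  assumes L: "2 \<le> L" and bin: "\<And>x. x < L \<Longrightarrow> \<zeta> x \<in> {0, 1}"
  shows "bij_betw (\<lambda>p. (p + headway L \<zeta> p) mod L)
    {p. p < L \<and> \<zeta> p = 1 \<and> headway L \<zeta> p \<ge> 1} {x. x < L \<and> \<zeta> x = 0 \<and> \<zeta> ((x + 1) mod L) = 1}"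
    (is "bij_betw ?F ?P ?S")
  unfolding bij_betw_def
proof (intro conjI inj_onI subset_antisym subsetI)
  fix p q assume p: "p \<in> ?P" and q: "q \<in> ?P" and e: "?F p = ?F q"
  define g where "g = (\<lambda>i. \<zeta> ((p + i) mod L))"
  have g0: "g 0 = 1" "g L = 1" using p by (simp_all add: g_def)
  obtain c where c: "c < L" "q = (p + c) mod L"
    using bij_shift[of L p] q L unfolding bij_betw_def by (metis (no_types, lifting) imageE lessThan_iff mem_Collect_eq less_le_trans zero_less_numeral)
  have gc: "g c = 1" using c q by (simp add: g_def)
  note gp = gap_props[of g L 0, OF g0(2)] and gq = gap_props[of g L c, OF g0(2) c(1)]
  have hp: "headway L \<zeta> p = gap g 0" unfolding g_def headway_0 ..
  have hq: "headway L \<zeta> q = gap g c" unfolding c(2) g_def headway_shift ..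
  have "(p + gap g 0) mod L = (p + (c + gap g c)) mod L"
    using e hp hq unfolding c(2) by (simp add: mod_add_left_eq add.assoc)
  then have "gap g 0 = c + gap g c" 
    by (rule shift_mod_inj) (use gp(2) gq(2) L in linarith)+
  then have "c = 0" using gp(3)[of c] gc L by (cases "c = 0") auto
  then show "p = q" using c p by simp
next
  fix x assume "x \<in> ?F ` ?P"
  then obtain p where p: "p < L" "\<zeta> p = 1" "headway L \<zeta> p \<ge> 1" "x = ?F p" by auto
  define g where "g = (\<lambda>i. \<zeta> ((p + i) mod L))"
  have gL: "g L = 1" using p by (simp_all add: g_def)
  note gp = gap_props[of g L 0, OF gL]
  have hp: "headway L \<zeta> p = gap g 0" unfolding g_def headway_0 ..
  have "\<zeta> x \<noteq> 1" using gp(3)[of "gap g 0"] p L unfolding hp by (simp add: g_def)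
  moreover have "\<zeta> ((x + 1) mod L) = 1" using gp(1) p L unfolding hp
    by (simp add: g_def mod_Suc_eq)
  moreover have "x < L" using p(4) L by simp
  ultimately show "x \<in> ?S" using bin[of x] by auto
next
  fix x assume x: "x \<in> ?S"
  define k where "k = (LEAST k. \<zeta> ((x + L - k) mod L) = 1)"
  have w: "\<zeta> ((x + L - (L - 1)) mod L) = 1" using x L by simp
  have k1: "\<zeta> ((x + L - k) mod L) = 1" unfolding k_def by (rule LeastI) (rule w)
  have kL: "k \<le> L - 1" unfolding k_def by (rule Least_le) (rule w)
  have kl: "\<zeta> ((x + L - j) mod L) \<noteq> 1" if "j < k" for j
    using not_less_Least[of j "\<lambda>k. \<zeta> ((x + L - k) mod L) = 1"] that unfolding k_def by blast
  have k0: "k \<ge> 1" using k1 x by (cases k) auto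
  define p where "p = (x + L - k) mod L"
  have hk: "headway L \<zeta> p = k"
    unfolding headway_def
  proof (rule Least_equality)
    have "(p + k + 1) mod L = (x + L - k + k + 1) mod L" unfolding p_def by (metis mod_add_left_eq add.assoc)
    also have "\<dots> = (x + 1) mod L" using kL by (simp add: mod_Suc)
    finally show "\<zeta> ((p + k + 1) mod L) = 1" using x by simp
  next
    fix j assume j: "\<zeta> ((p + j + 1) mod L) = 1"
    show "k \<le> j"
    proof (rule ccontr)
      assume a: "\<not> k \<le> j"
      have "(p + j + 1) mod L = (x + L - k + j + 1) mod L" unfolding p_def by (metis mod_add_left_eq add.assoc)
      also have "x + L - k + j + 1 = x + L - (k - j - 1)" using a kL by linarith
      finally show False using j kl[of "k - j - 1"] a by simp
    qed
  qed
  have "x = (p + k) mod L" unfolding p_def using kL x by (simp add: mod_add_left_eq)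
  moreover have "p < L" unfolding p_def using L by simp
  moreover have "\<zeta> p = 1" using k1 unfolding p_def .
  ultimately show "x \<in> ?F ` ?P" using hk k0 by (intro image_eqI[of _ _ p]) auto
qed

lemma finite_configs_can: "finite (configs_can L N)"
proof -
  have "finite ({..<L} \<rightarrow>\<^sub>E {0, 1::nat})" by (rule finite_PiE) auto
  then show ?thesis unfolding configs_can_def by simp
qed

lemma exchange_configs:
  assumes "x < L" "s < L" "x \<noteq> s" "\<eta> \<in> configs_can L N"
  shows "exchange \<eta> x s \<in> configs_can L N"
proof -
  have "(\<Sum>z<L. exchange \<eta> x s z) = (\<Sum>z<L. \<eta> z)"
    by (rule sum.reindex_bij_witness[of _ "\<lambda>z. if z = x then s else if z = s then x else z" "\<lambda>z. if z = x then s else if z = s then x else z"])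
      (use assms in \<open>auto simp: exchange_def\<close>)
  moreover have "exchange \<eta> x s \<in> {..<L} \<rightarrow>\<^sub>E {0, 1}"
    using assms unfolding configs_can_def exchange_def by (auto simp: PiE_iff extensional_def)
  ultimately show ?thesis using assms unfolding configs_can_def by simp
qed

lemma exchange_exchange: "exchange (exchange \<eta> x s) x s = \<eta>"
  unfolding exchange_def by auto

lemma headway_measure_can_invariant:
  fixes y w :: "nat \<Rightarrow> real"
  assumes y0: "y 0 = 0" and pos: "\<And>k. k \<ge> 1 \<Longrightarrow> y k > 0"
    and w: "\<And>n. w n = v * y n / y (n + 1)"
  shows "expectation_can y L N (tahep_generator w L f) = 0"
proof (cases "2 \<le> L")
  case False
  then have "L = 0 \<or> L = 1" by auto
  then show ?thesis
    unfolding expectation_can_def tahep_generator_def exchange_def by auto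
next
  case L: True
  let ?s = "\<lambda>x. (x + 1) mod L" and ?\<Omega> = "configs_can L N" and ?\<pi> = "headway_weight y L"
  define A where "A x = {\<eta> \<in> ?\<Omega>. \<eta> x = 1 \<and> \<eta> (?s x) = 0}" for x
  define B where "B x = {\<eta> \<in> ?\<Omega>. \<eta> x = 0 \<and> \<eta> (?s x) = 1}" for x
  have bin: "\<eta> x = 0 \<or> \<eta> x = 1" if "\<eta> \<in> ?\<Omega>" "x < L" for \<eta> x
    using that unfolding configs_can_def by (auto simp: PiE_iff)
  have w0: "w 0 = 0" using w y0 by simp
  have hw0: "headway L \<eta> x = 0" if "\<eta> (?s x) = 1" for \<eta> x
    unfolding headway_def using that by (intro Least_equality) auto
  have sL: "?s x < L" "?s x \<noteq> x" if "x < L" for x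
    using that L by (auto simp: mod_Suc)
  have "(\<Sum>\<eta>\<in>?\<Omega>. \<Sum>x<L. ?\<pi> \<eta> * exit_rate w L x \<eta> * f (exchange \<eta> x (?s x)))
      = (\<Sum>x<L. \<Sum>\<eta>\<in>?\<Omega>. ?\<pi> \<eta> * exit_rate w L x \<eta> * f (exchange \<eta> x (?s x)))"
    by (rule sum.swap)
  also have "\<dots> = (\<Sum>x<L. \<Sum>\<eta>\<in>A x. ?\<pi> \<eta> * w (headway L \<eta> x) * f (exchange \<eta> x (?s x)))"
  proof (rule sum.cong)
    fix x assume x: "x \<in> {..<L}"
    have "(\<Sum>\<eta>\<in>A x. ?\<pi> \<eta> * w (headway L \<eta> x) * f (exchange \<eta> x (?s x)))
       = (\<Sum>\<eta>\<in>A x. ?\<pi> \<eta> * exit_rate w L x \<eta> * f (exchange \<eta> x (?s x)))"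
      by (rule sum.cong) (use x in \<open>auto simp: A_def exit_rate_eq\<close>)
    also have "\<dots> = (\<Sum>\<eta>\<in>?\<Omega>. ?\<pi> \<eta> * exit_rate w L x \<eta> * f (exchange \<eta> x (?s x)))"
    proof (rule sum.mono_neutral_left)
      show "\<forall>\<eta>\<in>?\<Omega> - A x. ?\<pi> \<eta> * exit_rate w L x \<eta> * f (exchange \<eta> x (?s x)) = 0"
      proof
        fix \<eta> assume \<eta>: "\<eta> \<in> ?\<Omega> - A x"
        then have "\<eta> x \<noteq> 1 \<or> \<eta> (?s x) = 1" using bin[of \<eta> "?s x"] sL[of x] x by (auto simp: A_def)
        then have "exit_rate w L x \<eta> = 0" using x hw0 w0 by (auto simp: exit_rate_eq)
        then show "?\<pi> \<eta> * exit_rate w L x \<eta> * f (exchange \<eta> x (?s x)) = 0" by simp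
      qed
    qed (auto simp: A_def finite_configs_can)
    finally show "(\<Sum>\<eta>\<in>?\<Omega>. ?\<pi> \<eta> * exit_rate w L x \<eta> * f (exchange \<eta> x (?s x)))
       = (\<Sum>\<eta>\<in>A x. ?\<pi> \<eta> * w (headway L \<eta> x) * f (exchange \<eta> x (?s x)))" ..
  qed simp
  also have "\<dots> = (\<Sum>x<L. \<Sum>\<zeta>\<in>B x. ?\<pi> (exchange \<zeta> x (?s x)) * w (headway L (exchange \<zeta> x (?s x)) x) * f \<zeta>)"
  proof (rule sum.cong)
    fix x assume x: "x \<in> {..<L}"
    have ab: "exchange \<eta> x (?s x) \<in> B x" if "\<eta> \<in> A x" for \<eta>
      using that exchange_configs[of x L "?s x" \<eta> N] sL[of x] x unfolding A_def B_def by (auto simp: exchange_def)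
    have ba: "exchange \<eta> x (?s x) \<in> A x" if "\<eta> \<in> B x" for \<eta>
      using that exchange_configs[of x L "?s x" \<eta> N] sL[of x] x unfolding A_def B_def by (auto simp: exchange_def)
    show "(\<Sum>\<eta>\<in>A x. ?\<pi> \<eta> * w (headway L \<eta> x) * f (exchange \<eta> x (?s x)))
       = (\<Sum>\<zeta>\<in>B x. ?\<pi> (exchange \<zeta> x (?s x)) * w (headway L (exchange \<zeta> x (?s x)) x) * f \<zeta>)"
      by (rule sum.reindex_bij_witness[of _ "\<lambda>\<eta>. exchange \<eta> x (?s x)" "\<lambda>\<eta>. exchange \<eta> x (?s x)"])
        (use ab ba in \<open>simp_all add: exchange_exchange\<close>)
  qed simp
  also have "\<dots> = (\<Sum>\<zeta>\<in>?\<Omega>. \<Sum>x\<in>{x. x < L \<and> \<zeta> x = 0 \<and> \<zeta> (?s x) = 1}.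
      ?\<pi> (exchange \<zeta> x (?s x)) * w (headway L (exchange \<zeta> x (?s x)) x) * f \<zeta>)"
    using sum.swap_restrict[of "{..<L}" ?\<Omega>
        "\<lambda>x \<zeta>. ?\<pi> (exchange \<zeta> x (?s x)) * w (headway L (exchange \<zeta> x (?s x)) x) * f \<zeta>"
        "\<lambda>x \<zeta>. \<zeta> x = 0 \<and> \<zeta> (?s x) = 1"] finite_configs_can
    by (simp add: B_def)
  also have "\<dots> = (\<Sum>\<zeta>\<in>?\<Omega>. \<Sum>x<L. ?\<pi> \<zeta> * exit_rate w L x \<zeta> * f \<zeta>)"
  proof (rule sum.cong)
    fix \<zeta> assume \<zeta>: "\<zeta> \<in> ?\<Omega>"
    let ?P = "{p. p < L \<and> \<zeta> p = 1 \<and> headway L \<zeta> p \<ge> 1}"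
    let ?h = "\<lambda>x. ?\<pi> (exchange \<zeta> x (?s x)) * w (headway L (exchange \<zeta> x (?s x)) x) * f \<zeta>"
    have "(\<Sum>x\<in>{x. x < L \<and> \<zeta> x = 0 \<and> \<zeta> (?s x) = 1}. ?h x)
       = (\<Sum>p\<in>?P. ?h ((p + headway L \<zeta> p) mod L))"
      by (rule sum.reindex_bij_betw[symmetric], rule jump_bij[OF L]) (use bin[OF \<zeta>] in auto)
    also have "\<dots> = (\<Sum>p\<in>?P. ?\<pi> \<zeta> * w (headway L \<zeta> p) * f \<zeta>)"
    proof (rule sum.cong)
      fix p assume p: "p \<in> ?P"
      then show "?h ((p + headway L \<zeta> p) mod L) = ?\<pi> \<zeta> * w (headway L \<zeta> p) * f \<zeta>"
        using jump_balance[where y=y and w=w and v=v and L=L and p=p and \<zeta>=\<zeta>, OF pos w L _ _ refl _ refl] by simp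
    qed simp
    also have "\<dots> = (\<Sum>p\<in>?P. ?\<pi> \<zeta> * exit_rate w L p \<zeta> * f \<zeta>)"
      by (rule sum.cong) (auto simp: exit_rate_eq)
    also have "\<dots> = (\<Sum>x<L. ?\<pi> \<zeta> * exit_rate w L x \<zeta> * f \<zeta>)"
    proof (rule sum.mono_neutral_left)
      show "\<forall>i\<in>{..<L} - ?P. ?\<pi> \<zeta> * exit_rate w L i \<zeta> * f \<zeta> = 0"
        using w0 by (auto simp: exit_rate_eq not_less_eq_eq)
    qed auto
    finally show "(\<Sum>x\<in>{x. x < L \<and> \<zeta> x = 0 \<and> \<zeta> (?s x) = 1}. ?h x)
       = (\<Sum>x<L. ?\<pi> \<zeta> * exit_rate w L x \<zeta> * f \<zeta>)" .
  qed simp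
  finally have "(\<Sum>\<eta>\<in>?\<Omega>. ?\<pi> \<eta> * tahep_generator w L f \<eta>) = 0"
    unfolding tahep_generator_def
    by (simp add: sum_distrib_left right_diff_distrib sum_subtractf mult.assoc)
  moreover have "expectation_can y L N (tahep_generator w L f)
     = (\<Sum>\<eta>\<in>?\<Omega>. ?\<pi> \<eta> * tahep_generator w L f \<eta>) / partition_can y L N"
    unfolding expectation_can_def headway_measure_can_def by (simp add: sum_divide_distrib)
  ultimately show ?thesis by simp
qed

lemma tahep_invariant:
  assumes J: "\<And>k. k \<ge> 1 \<Longrightarrow> \<bar>J k\<bar> \<noteq> \<infinity>"
  shows "expectation_can (pot_weight J) L N (tahep_generator (tahep_rate w J) L f) = 0"
proof (rule headway_measure_can_invariant)
  fix n
  show "tahep_rate w J n = w * pot_weight J n / pot_weight J (n + 1)"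
  proof (cases "n = 0")
    case False
    then have "real_of_ereal (J (n + 1) - J n) = real_of_ereal (J (n + 1)) - real_of_ereal (J n)"
      using J[of n] J[of "n + 1"] by (cases "J n"; cases "J (n + 1)") auto
    then show ?thesis using False
      by (simp add: tahep_rate_def pot_weight_def exp_diff exp_minus divide_simps)
  qed (simp add: tahep_rate_def pot_weight_def)
qed (simp_all add: pot_weight_def)

end

theory Submission
  imports Defs "HOL-Real_Asymp.Real_Asymp"
begin

unbundle no vec_syntax
unbundle fps_syntax

text \<open>
  Let \<open>P\<close> be the power series with coefficients \<open>y (k + 1)\<close> and \<open>M = L - N\<close>. Cutting the torus at a particle shows that
  the stationary current is \<open>w (N / L) R\<close>, where \<open>R\<close> is the quotient of the coefficients of \<open>P ^ N\<close> at \<open>M - 1\<close> and \<open>M\<close>.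
  Equivalently, \<open>R\<close> is the expectation of the average of \<open>g k = y k / y (k + 1)\<close> over \<open>N\<close> independent headways
  conditioned on having sum \<open>M\<close>. Under the unconditioned grand canonical law with fugacity \<open>u\<close>, the bounded variables \<open>g k\<close> have
  mean \<open>u\<close>, so by Jensen's inequality and a Chernoff bound \<open>R\<close> is close to \<open>u\<close> as soon as the conditioning event has
  probability at least \<open>exp (- o(N))\<close>. This is arranged by taking \<open>u\<close> close to \<open>\<phi> (1 / \<rho> - 1)\<close> or, above the critical
  headway, to \<open>u\<^sub>c\<close>. Since \<open>y n / y (n + 1)\<close> is bounded, enlarging the sum by \<open>k\<close> costs at most a factor exponential
  in \<open>k\<close>, so it suffices to reach values slightly below \<open>M\<close>. Above the critical headway the excess is put into a few
  gaps of a fixed large length \<open>K\<close> with \<open>y (K + 1) * u ^ K \<ge> exp (- \<delta> K)\<close>; no regularity of \<open>y\<close> is needed for such \<open>K\<close>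
  to exist.
\<close>

subsection \<open>Combinatorics of the canonical ensemble\<close>

definition next_elem :: "nat set \<Rightarrow> nat \<Rightarrow> nat" where
  "next_elem S c = (LEAST d. c < d \<and> d \<in> S)"

lemma next_elem_props:
  assumes "d \<in> S" "c < d"
  shows "c < next_elem S c" "next_elem S c \<in> S" "next_elem S c \<le> d"
proof -
  have "c < next_elem S c \<and> next_elem S c \<in> S"
    unfolding next_elem_def by (rule LeastI[of _ d]) (use assms in simp)
  then show "c < next_elem S c" "next_elem S c \<in> S" by auto
  show "next_elem S c \<le> d"
    unfolding next_elem_def by (rule Least_le) (use assms in simp)
qed

lemma next_elem_notin: "c < j \<Longrightarrow> j < next_elem S c \<Longrightarrow> j \<notin> S"
  unfolding next_elem_def using not_less_Least by blast

lemma next_elem_eqI: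
  assumes "c < d" "d \<in> S" "\<And>j. c < j \<Longrightarrow> j < d \<Longrightarrow> j \<notin> S"
  shows "next_elem S c = d"
  unfolding next_elem_def by (rule Least_equality) (use assms not_less in blast)+

text \<open>The end marker \<open>L\<close> stands for the return to site 0 of the torus and closes
  the last gap. The weight \<open>f\<close> may depend on the left end of a gap, because the gap
  starting at 0 will be weighted differently.\<close>

definition gap_prod :: "(nat \<Rightarrow> nat \<Rightarrow> real) \<Rightarrow> nat \<Rightarrow> nat set \<Rightarrow> real" where
  "gap_prod f L S = (\<Prod>c\<in>S. f c (next_elem (insert L S) c - c))"

text \<open>The new maximum \<open>m\<close> closes the gaps of \<open>S\<close> exactly as the end
  marker \<open>m\<close> did, and opens one more gap, which runs up to \<open>L\<close>.\<close>

lemma gap_prod_insert: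
  assumes "S \<subseteq> {..<m}" "m < L"
  shows "gap_prod f L (insert m S) = f m (L - m) * gap_prod f m S"
proof -
  have m: "next_elem (insert L (insert m S)) m = L"
    by (rule next_elem_eqI) (use assms in auto)
  have c: "next_elem (insert L (insert m S)) c = next_elem (insert m S) c" if "c \<in> S" for c
  proof (rule next_elem_eqI)
    have cm: "c < m" using that assms by auto
    note N = next_elem_props[of m "insert m S" c, OF insertI1 cm]
    show "c < next_elem (insert m S) c" "next_elem (insert m S) c \<in> insert L (insert m S)"
      using N by auto
    show "j \<notin> insert L (insert m S)" if "c < j" "j < next_elem (insert m S) c" for j
      using next_elem_notin[OF that] that N(3) assms(2) by auto
  qed
  have "finite S" "m \<notin> S" using assms(1) finite_subset by auto
  then show ?thesis unfolding gap_prod_def by (simp add: m c)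
qed

definition rooted_sets :: "nat \<Rightarrow> nat \<Rightarrow> nat set set" where
  "rooted_sets L N = {S. S \<subseteq> {..<L} \<and> 0 \<in> S \<and> card S = N}"

lemma finite_rooted_sets: "finite (rooted_sets L N)"
  unfolding rooted_sets_def by (rule finite_subset[of _ "Pow {..<L}"]) auto

lemma rooted_sets_0: "rooted_sets 0 N = {}"
  unfolding rooted_sets_def by auto

lemma sum_gap_prod_1: "(\<Sum>S\<in>rooted_sets L 1. gap_prod f L S) = (if L = 0 then 0 else f 0 L)"
proof (cases "L = 0")
  case False
  have "rooted_sets L 1 = {{0}}"
    unfolding rooted_sets_def using False by (auto simp: card_1_singleton_iff)
  moreover have "next_elem {L, 0} 0 = L" by (rule next_elem_eqI) (use False in auto)
  ultimately show ?thesis using False by (simp add: gap_prod_def)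
qed (simp add: rooted_sets_0)

text \<open>The sum is split according to the maximum \<open>m\<close>, whose removal leaves a
  rooted set below \<open>m\<close>.\<close>

lemma sum_gap_prod_Suc:
  assumes "N \<ge> 1"
  shows "(\<Sum>S\<in>rooted_sets L (Suc N). gap_prod f L S)
    = (\<Sum>m<L. f m (L - m) * (\<Sum>S\<in>rooted_sets m N. gap_prod f m S))"
proof -
  have fin: "finite S" if "S \<in> rooted_sets m n" for S m n
    using that unfolding rooted_sets_def by (auto intro: finite_subset)
  have "(\<Sum>m<L. f m (L - m) * (\<Sum>S\<in>rooted_sets m N. gap_prod f m S))
      = (\<Sum>(m, S)\<in>Sigma {..<L} (\<lambda>m. rooted_sets m N). f m (L - m) * gap_prod f m S)"
    by (simp add: sum_distrib_left sum.Sigma finite_rooted_sets)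
  also have "\<dots> = (\<Sum>S\<in>rooted_sets L (Suc N). gap_prod f L S)"
  proof (rule sum.reindex_bij_witness[of _ "\<lambda>S. (Max S, S - {Max S})" "\<lambda>(m, S). insert m S"])
    fix a assume a: "a \<in> Sigma {..<L} (\<lambda>m. rooted_sets m N)"
    obtain m S where mS: "a = (m, S)" by (cases a)
    have S: "m < L" "S \<subseteq> {..<m}" "0 \<in> S" "card S = N" "finite S" "m \<notin> S"
      using a fin[of S m N] unfolding mS rooted_sets_def by auto
    have "Max (insert m S) = m" by (rule Max_eqI) (use S in auto)
    then show "(Max (case a of (m, S) \<Rightarrow> insert m S),
        (case a of (m, S) \<Rightarrow> insert m S) - {Max (case a of (m, S) \<Rightarrow> insert m S)}) = a"
      using S unfolding mS by simp
    show "(case a of (m, S) \<Rightarrow> insert m S) \<in> rooted_sets L (Suc N)"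
      using S unfolding mS rooted_sets_def by auto
    show "gap_prod f L (case a of (m, S) \<Rightarrow> insert m S) = (case a of (m, S) \<Rightarrow> f m (L - m) * gap_prod f m S)"
      using gap_prod_insert[OF S(2,1)] unfolding mS by simp
  next
    fix S assume S: "S \<in> rooted_sets L (Suc N)"
    then have f: "finite S" "S \<noteq> {}" and S': "S \<subseteq> {..<L}" "0 \<in> S" "card S = Suc N"
      using fin[of S L "Suc N"] unfolding rooted_sets_def by auto
    note M = Max_in[OF f]
    show "(case (Max S, S - {Max S}) of (m, S) \<Rightarrow> insert m S) = S" using M by auto
    \<comment> \<open>Site 0 has to survive the removal of the maximum.\<close>
    have "Max S \<noteq> 0"
    proof
      assume 0: "Max S = 0"
      have "\<forall>x\<in>S. x \<le> 0" using Max_ge[OF f(1)] 0 by metis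
      then have "S \<subseteq> {0}" by auto
      then have "card S \<le> card {0::nat}" by (rule card_mono[rotated]) simp
      then show False using S' assms by simp
    qed
    moreover have "S - {Max S} \<subseteq> {..<Max S}"
      using Max_ge[OF f(1)] by (auto simp: order.strict_iff_order)
    ultimately show "(Max S, S - {Max S}) \<in> Sigma {..<L} (\<lambda>m. rooted_sets m N)"
      using S' M f unfolding rooted_sets_def by auto
  qed
  finally show ?thesis ..
qed

text \<open>Induction on the number of gaps: peeling off the last gap is a Cauchy product with
  \<open>Abs_fps y\<close>, and the gap starting at 0 remains as the single factor
  \<open>Abs_fps z\<close>.\<close>

lemma sum_gap_prod_fps:
  fixes y z :: "nat \<Rightarrow> real"
  assumes y0: "y 0 = 0" and z0: "z 0 = 0"
  shows "(\<Sum>S\<in>rooted_sets L (Suc n). gap_prod (\<lambda>c. if c = 0 then z else y) L S)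
    = (Abs_fps z * Abs_fps y ^ n) $ L"
proof (induction n arbitrary: L)
  case 0
  then show ?case using sum_gap_prod_1[where L = L] z0 by simp
next
  case (Suc n)
  let ?f = "\<lambda>c. if c = 0 then z else y"
  have "(\<Sum>S\<in>rooted_sets L (Suc (Suc n)). gap_prod ?f L S)
      = (\<Sum>m<L. ?f m (L - m) * (\<Sum>S\<in>rooted_sets m (Suc n). gap_prod ?f m S))"
    by (rule sum_gap_prod_Suc) simp
  \<comment> \<open>For \<open>m = 0\<close> the weight is \<open>z\<close> instead of
    \<open>y\<close>, but \<open>rooted_sets 0\<close> is empty, so the term vanishes on both
    sides.\<close>
  also have "\<dots> = (\<Sum>m<L. y (L - m) * (Abs_fps z * Abs_fps y ^ n) $ m)"
    unfolding Suc.IH[symmetric] by (rule sum.cong) (auto simp: rooted_sets_0)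
  also have "\<dots> = (\<Sum>m=0..L. (Abs_fps z * Abs_fps y ^ n) $ m * Abs_fps y $ (L - m))"
    by (rule sum.mono_neutral_cong_left) (auto simp: y0)
  also have "\<dots> = (Abs_fps z * Abs_fps y ^ n * Abs_fps y) $ L" unfolding fps_mult_nth ..
  finally show ?case by (simp add: ac_simps)
qed

text \<open>Since site 0 is occupied, the search around the torus stops at \<open>L\<close> at the
  latest. The distance between consecutive particles exceeds the number of empty sites between them
  by one.\<close>

lemma headway_eq_next_elem:
  assumes "\<eta> 0 = 1" "c < L"
  shows "headway L \<eta> c + 1 = next_elem (insert L {x. x < L \<and> \<eta> x = 1}) c - c"
proof -
  let ?S = "insert L {x. x < L \<and> \<eta> x = 1}"
  note N = next_elem_props[of L ?S c, OF insertI1 assms(2)]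
  have "headway L \<eta> ((0 + c) mod L) = next_elem ?S c - c - 1"
    unfolding headway_shift
  proof (rule gap_eqI)
    have "\<eta> (next_elem ?S c mod L) = 1" using N assms by auto
    then show "\<eta> ((0 + (c + (next_elem ?S c - c - 1) + 1)) mod L) = 1" using N(1) by simp
    fix j assume "c < j" "j \<le> c + (next_elem ?S c - c - 1)"
    then have j: "c < j" "j < next_elem ?S c" using N(1) by auto
    then show "\<eta> ((0 + j) mod L) \<noteq> 1" using next_elem_notin[OF j] N(3) by auto
  qed
  then show ?thesis using N(1) assms by simp
qed

text \<open>The domain includes the condition \<open>L > 0\<close> because for \<open>L = 0\<close>
  the value \<open>\<eta> 0\<close> is \<open>undefined\<close>, whereas
  \<open>rooted_sets 0 N\<close> is empty.\<close>

lemma bij_betw_configs_sets: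
  "bij_betw (\<lambda>\<eta>. {x. x < L \<and> \<eta> x = 1}) {\<eta> \<in> configs_can L N. \<eta> 0 = 1 \<and> L > 0} (rooted_sets L N)"
proof (rule bij_betw_byWitness[where f' = "\<lambda>S. \<lambda>x. if x < L then (if x \<in> S then 1 else 0) else undefined"])
  have S: "(\<Sum>x<L. \<eta> x) = card {x. x < L \<and> \<eta> x = 1}" if "\<eta> \<in> {..<L} \<rightarrow>\<^sub>E {0, 1}" for \<eta> :: "nat \<Rightarrow> nat"
  proof -
    have "(\<Sum>x<L. \<eta> x) = (\<Sum>x<L. if \<eta> x = 1 then 1 else 0)"
      by (rule sum.cong) (use that in \<open>auto simp: PiE_iff\<close>)
    also have "\<dots> = card {x. x < L \<and> \<eta> x = 1}" by (simp add: sum.If_cases Int_def)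
    finally show ?thesis .
  qed
  show "\<forall>\<eta>\<in>{\<eta> \<in> configs_can L N. \<eta> 0 = 1 \<and> L > 0}.
     (\<lambda>x. if x < L then if x \<in> {x. x < L \<and> \<eta> x = 1} then 1 else 0 else undefined) = \<eta>"
    by (auto simp: configs_can_def PiE_iff extensional_def fun_eq_iff)
  show "\<forall>S\<in>rooted_sets L N. {x. x < L \<and> (if x < L then if x \<in> S then 1 else 0 else undefined) = (1::nat)} = S"
    by (auto simp: rooted_sets_def split: if_splits)
  show "(\<lambda>\<eta>. {x. x < L \<and> \<eta> x = 1}) ` {\<eta> \<in> configs_can L N. \<eta> 0 = 1 \<and> L > 0} \<subseteq> rooted_sets L N"
    using S by (auto simp: configs_can_def rooted_sets_def)
  show "(\<lambda>S x. if x < L then if x \<in> S then 1 else 0 else undefined) ` rooted_sets L N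
    \<subseteq> {\<eta> \<in> configs_can L N. \<eta> 0 = 1 \<and> L > 0}"
  proof (intro image_subsetI CollectI conjI)
    fix S assume "S \<in> rooted_sets L N"
    then have S': "S \<subseteq> {..<L}" "0 \<in> S" "card S = N" by (auto simp: rooted_sets_def)
    let ?\<eta> = "\<lambda>x. if x < L then if x \<in> S then 1 else 0 else undefined :: nat"
    have p: "?\<eta> \<in> {..<L} \<rightarrow>\<^sub>E {0, 1}" by (auto simp: PiE_iff extensional_def)
    have "{x. x < L \<and> ?\<eta> x = 1} = S" using S' by (auto split: if_splits)
    then show "?\<eta> \<in> configs_can L N" using S[OF p] p S' by (simp add: configs_can_def)
    show "?\<eta> 0 = 1" "L > 0" using S' by auto
  qed
qed

text \<open>Singling out the headway of the particle at 0 serves two purposes: \<open>z = y\<close>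
  yields the partition sum with site 0 occupied, and a \<open>z\<close> that includes the jump rate
  yields the current out of site 0.\<close>

lemma sum_configs_fps:
  fixes y z :: "nat \<Rightarrow> real"
  assumes y0: "y 0 = 0" and z0: "z 0 = 0" and L: "L > 0"
  shows "(\<Sum>\<eta>\<in>{\<eta> \<in> configs_can L (Suc n). \<eta> 0 = 1}.
      z (headway L \<eta> 0 + 1) * (\<Prod>x\<in>{x. x < L \<and> \<eta> x = 1} - {0}. y (headway L \<eta> x + 1)))
    = (Abs_fps z * Abs_fps y ^ n) $ L"
proof -
  let ?f = "\<lambda>c. if c = 0 then z else y"
  have "(\<Sum>S\<in>rooted_sets L (Suc n). gap_prod ?f L S)
     = (\<Sum>\<eta>\<in>{\<eta> \<in> configs_can L (Suc n). \<eta> 0 = 1}. gap_prod ?f L {x. x < L \<and> \<eta> x = 1})"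
    using L sum.reindex_bij_betw[OF bij_betw_configs_sets, of "gap_prod ?f L" L "Suc n"] by simp
  also have "\<dots> = (\<Sum>\<eta>\<in>{\<eta> \<in> configs_can L (Suc n). \<eta> 0 = 1}.
      z (headway L \<eta> 0 + 1) * (\<Prod>x\<in>{x. x < L \<and> \<eta> x = 1} - {0}. y (headway L \<eta> x + 1)))"
  proof (rule sum.cong[OF refl])
    fix \<eta> assume \<eta>: "\<eta> \<in> {\<eta> \<in> configs_can L (Suc n). \<eta> 0 = 1}"
    let ?S = "{x. x < L \<and> \<eta> x = 1}"
    have S: "finite ?S" "0 \<in> ?S" using \<eta> L by auto
    have "gap_prod ?f L ?S = (\<Prod>x\<in>?S. ?f x (headway L \<eta> x + 1))"
      unfolding gap_prod_def using \<eta>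
      by (intro prod.cong refl arg_cong2[of _ _ _ _ ?f] headway_eq_next_elem[symmetric]) auto
    also have "\<dots> = z (headway L \<eta> 0 + 1) * (\<Prod>x\<in>?S - {0}. ?f x (headway L \<eta> x + 1))"
      unfolding prod.remove[OF S] by simp
    also have "(\<Prod>x\<in>?S - {0}. ?f x (headway L \<eta> x + 1)) = (\<Prod>x\<in>?S - {0}. y (headway L \<eta> x + 1))"
      by (rule prod.cong) auto
    finally show "gap_prod ?f L ?S = z (headway L \<eta> 0 + 1) * (\<Prod>x\<in>?S - {0}. y (headway L \<eta> x + 1))" .
  qed
  finally show ?thesis
    using sum_gap_prod_fps[where y = y and z = z and L = L and n = n, OF y0 z0] by simp
qed

section \<open>Rotation invariance and rooting of the partition function\<close>

definition rotate_config :: "nat \<Rightarrow> nat \<Rightarrow> (nat \<Rightarrow> nat) \<Rightarrow> nat \<Rightarrow> nat" where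
  "rotate_config L p \<eta> = restrict (\<lambda>i. \<eta> ((p + i) mod L)) {..<L}"

lemma rotate_config_configs:
  assumes "L > 0" "\<eta> \<in> configs_can L N"
  shows "rotate_config L p \<eta> \<in> configs_can L N"
proof -
  have "(\<Sum>i<L. rotate_config L p \<eta> i) = (\<Sum>i<L. \<eta> ((p + i) mod L))"
    by (simp add: rotate_config_def)
  also have "\<dots> = (\<Sum>i<L. \<eta> i)"
    by (rule sum.reindex_bij_betw[OF bij_shift[OF assms(1)]])
  finally show ?thesis
    using assms by (auto simp: configs_can_def rotate_config_def PiE_iff)
qed

lemma rotate_config_inverse:
  assumes "\<eta> \<in> configs_can L N" "p \<le> L"
  shows "rotate_config L p (rotate_config L (L - p) \<eta>) = \<eta>"
    and "rotate_config L (L - p) (rotate_config L p \<eta>) = \<eta>"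
proof -
  have "(L - p + (p + i) mod L) mod L = i" "(p + (L - p + i) mod L) mod L = i" if "i < L" for i
    unfolding mod_add_right_eq using that assms(2) by simp_all
  then show "rotate_config L p (rotate_config L (L - p) \<eta>) = \<eta>"
    "rotate_config L (L - p) (rotate_config L p \<eta>) = \<eta>"
    using assms(1) by (auto simp: rotate_config_def configs_can_def PiE_iff extensional_def fun_eq_iff)
qed

text \<open>Both weights come from \<open>headway_weight_shift\<close>, the rotated one cut at 0 and
  the original one cut at \<open>p\<close>; the two cut configurations coincide.\<close>

lemma headway_weight_rotate:
  assumes "L > 0"
  shows "headway_weight y L (rotate_config L p \<eta>) = headway_weight y L \<eta>"
proof -
  have "rotate_config L p \<eta> ((0 + i) mod L) = \<eta> ((p + i) mod L)" for i
    using assms by (simp add: rotate_config_def mod_add_right_eq)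
  then show ?thesis
    using headway_weight_shift[OF assms, of y "rotate_config L p \<eta>" 0]
      headway_weight_shift[OF assms, of y \<eta> p] by simp
qed

lemma sum_headway_weight_site:
  assumes "p < L"
  shows "(\<Sum>\<eta>\<in>{\<eta> \<in> configs_can L N. \<eta> p = 1}. headway_weight y L \<eta>)
    = (\<Sum>\<eta>\<in>{\<eta> \<in> configs_can L N. \<eta> 0 = 1}. headway_weight y L \<eta>)"
proof (rule sum.reindex_bij_witness[of _ "rotate_config L (L - p)" "rotate_config L p"])
  have L: "L > 0" and pL: "p \<le> L" using assms by auto
  fix \<eta> assume "\<eta> \<in> {\<eta> \<in> configs_can L N. \<eta> p = 1}"
  then have \<eta>: "\<eta> \<in> configs_can L N" "\<eta> p = 1" by auto
  show "rotate_config L (L - p) (rotate_config L p \<eta>) = \<eta>"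
    by (rule rotate_config_inverse(2)[OF \<eta>(1) pL])
  show "rotate_config L p \<eta> \<in> {\<eta> \<in> configs_can L N. \<eta> 0 = 1}"
    using rotate_config_configs[OF L \<eta>(1)] \<eta>(2) assms by (auto simp: rotate_config_def)
  show "headway_weight y L (rotate_config L p \<eta>) = headway_weight y L \<eta>"
    by (rule headway_weight_rotate[OF L])
next
  have L: "L > 0" and pL: "p \<le> L" using assms by auto
  fix \<eta> assume "\<eta> \<in> {\<eta> \<in> configs_can L N. \<eta> 0 = 1}"
  then have \<eta>: "\<eta> \<in> configs_can L N" "\<eta> 0 = 1" by auto
  show "rotate_config L p (rotate_config L (L - p) \<eta>) = \<eta>"
    by (rule rotate_config_inverse(1)[OF \<eta>(1) pL])
  have "rotate_config L (L - p) \<eta> p = 1"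
    using \<eta>(2) assms by (simp add: rotate_config_def)
  then show "rotate_config L (L - p) \<eta> \<in> {\<eta> \<in> configs_can L N. \<eta> p = 1}"
    using rotate_config_configs[OF L \<eta>(1)] by simp
qed

text \<open>Pairs of a configuration and an occupied site are counted in two ways; by rotation
  invariance every site contributes as much as site 0.\<close>

lemma partition_can_rooted:
  assumes "L > 0"
  shows "N * partition_can y L N = L * (\<Sum>\<eta>\<in>{\<eta> \<in> configs_can L N. \<eta> 0 = 1}. headway_weight y L \<eta>)"
proof -
  have "N * partition_can y L N = (\<Sum>\<eta>\<in>configs_can L N. \<Sum>x<L. \<eta> x * headway_weight y L \<eta>)"
    unfolding partition_can_def sum_distrib_left
    by (rule sum.cong) (auto simp: configs_can_def sum_distrib_right[symmetric] simp flip: of_nat_sum)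
  also have "\<dots> = (\<Sum>x<L. \<Sum>\<eta>\<in>configs_can L N. \<eta> x * headway_weight y L \<eta>)"
    by (rule sum.swap)
  also have "\<dots> = (\<Sum>x<L. \<Sum>\<eta>\<in>{\<eta> \<in> configs_can L N. \<eta> x = 1}. headway_weight y L \<eta>)"
  proof (rule sum.cong[OF refl])
    fix x assume "x \<in> {..<L}"
    then have "\<eta> x = 0 \<or> \<eta> x = 1" if "\<eta> \<in> configs_can L N" for \<eta>
      using that by (auto simp: configs_can_def PiE_iff)
    then show "(\<Sum>\<eta>\<in>configs_can L N. \<eta> x * headway_weight y L \<eta>)
       = (\<Sum>\<eta>\<in>{\<eta> \<in> configs_can L N. \<eta> x = 1}. headway_weight y L \<eta>)"
      by (intro sum.mono_neutral_cong_right) (fastforce simp: finite_configs_can)+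
  qed
  also have "\<dots> = L * (\<Sum>\<eta>\<in>{\<eta> \<in> configs_can L N. \<eta> 0 = 1}. headway_weight y L \<eta>)"
    by (subst sum.cong[OF refl sum_headway_weight_site]) auto
  finally show ?thesis .
qed

section \<open>The current as a ratio of coefficients\<close>

lemma Abs_fps_shift_eq:
  assumes "y 0 = (0::real)" shows "Abs_fps y = fps_X * Abs_fps (\<lambda>k. y (k + 1))"
  by (rule fps_ext) (simp add: assms)

text \<open>Only configurations with a particle at 0 carry current. Since
  \<open>y (k + 1) * v k = w * y k\<close>, the jump rate shifts the weight of the first gap by one
  place, which lowers the index of the coefficient from \<open>L - N\<close> to
  \<open>L - N - 1\<close>. The factor \<open>N / L\<close> is the probability that site 0 is
  occupied.\<close>

lemma stationary_current_eq:
  fixes y v :: "nat \<Rightarrow> real"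
  assumes y0: "y 0 = 0" and pos: "\<And>k. k \<ge> 1 \<Longrightarrow> y k > 0"
    and v: "\<And>n. v n = w * y n / y (n + 1)" and N: "1 \<le> N" "N < L"
  shows "stationary_current v y L N = w * (N / L) *
    ((Abs_fps (\<lambda>k. y (k + 1)) ^ N) $ (L - N - 1) / (Abs_fps (\<lambda>k. y (k + 1)) ^ N) $ (L - N))"
proof -
  let ?F = "Abs_fps (\<lambda>k. y (k + 1))" and ?\<Omega> = "{\<eta> \<in> configs_can L N. \<eta> 0 = 1}"
  define Z where "Z = partition_can y L N"
  \<comment> \<open>For \<open>k \<ge> 1\<close> this is the weight \<open>y k\<close> of a gap of
    length \<open>k\<close> after site 0 times the rate \<open>v (k - 1)\<close>.\<close>
  define z where "z = (\<lambda>k. w * (if k = 0 then 0 else y (k - 1)))"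
  have L: "L > 0" using N by simp
  obtain n where n: "N = Suc n" using N by (cases N) auto
  have v0: "v 0 = 0" using v y0 by simp
  have Y: "Abs_fps y = fps_X * ?F" using y0 by (rule Abs_fps_shift_eq)
  have z: "Abs_fps z = fps_const w * (fps_X * Abs_fps y)"
    by (rule fps_ext) (simp add: z_def fps_X_mult_nth)
  have z0: "z 0 = 0" by (simp add: z_def)
  have W: "headway_weight y L \<eta> = y (headway L \<eta> 0 + 1) *
      (\<Prod>x\<in>{x. x < L \<and> \<eta> x = 1} - {0}. y (headway L \<eta> x + 1))" if "\<eta> 0 = 1" for \<eta>
    unfolding headway_weight_eq by (rule prod.remove) (use that L in auto)
  have YN: "Abs_fps y * Abs_fps y ^ n = fps_X ^ N * ?F ^ N"
    unfolding Y n power_mult_distrib power_Suc by (simp only: ac_simps)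
  have "(\<Sum>\<eta>\<in>?\<Omega>. headway_weight y L \<eta>) = (\<Sum>\<eta>\<in>?\<Omega>. y (headway L \<eta> 0 + 1) *
      (\<Prod>x\<in>{x. x < L \<and> \<eta> x = 1} - {0}. y (headway L \<eta> x + 1)))"
    by (rule sum.cong[OF refl], rule W) simp
  also have "\<dots> = (Abs_fps y * Abs_fps y ^ n) $ L"
    unfolding n by (rule sum_configs_fps[where y = y and z = y, OF y0 y0 L])
  also have "\<dots> = (?F ^ N) $ (L - N)" unfolding YN using N by (simp add: fps_X_power_mult_nth)
  finally have Z0: "(\<Sum>\<eta>\<in>?\<Omega>. headway_weight y L \<eta>) = (?F ^ N) $ (L - N)" .
  have zv: "y (k + 1) * v k = z (k + 1)" for k
    using pos[of "k + 1"] by (simp add: v z_def)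
  have "(\<Sum>\<eta>\<in>?\<Omega>. headway_weight y L \<eta> * v (headway L \<eta> 0)) = (\<Sum>\<eta>\<in>?\<Omega>. z (headway L \<eta> 0 + 1) *
      (\<Prod>x\<in>{x. x < L \<and> \<eta> x = 1} - {0}. y (headway L \<eta> x + 1)))"
  proof (rule sum.cong[OF refl])
    fix \<eta> assume "\<eta> \<in> ?\<Omega>"
    then have "\<eta> 0 = 1" by simp
    from W[of \<eta>, OF this] show "headway_weight y L \<eta> * v (headway L \<eta> 0) = z (headway L \<eta> 0 + 1) *
        (\<Prod>x\<in>{x. x < L \<and> \<eta> x = 1} - {0}. y (headway L \<eta> x + 1))"
      unfolding zv[symmetric] by simp
  qed
  also have "\<dots> = (Abs_fps z * Abs_fps y ^ n) $ L"
    unfolding n by (rule sum_configs_fps[where y = y and z = z, OF y0 z0 L])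
  also have "Abs_fps z * Abs_fps y ^ n = fps_const w * (fps_X ^ Suc N * ?F ^ N)"
    unfolding z power_Suc mult.assoc YN ..
  also have "(fps_const w * (fps_X ^ Suc N * ?F ^ N)) $ L = w * (?F ^ N) $ (L - N - 1)"
    using N by (simp add: fps_X_power_mult_nth del: power_Suc)
  finally have C0: "(\<Sum>\<eta>\<in>?\<Omega>. headway_weight y L \<eta> * v (headway L \<eta> 0)) = w * (?F ^ N) $ (L - N - 1)" .
  \<comment> \<open>The ranges of summation differ only by \<open>n = 0\<close>, where
    \<open>v 0 = 0\<close>.\<close>
  have "instantaneous_current v L 0 \<eta> = exit_rate v L 0 \<eta>" for \<eta>
    unfolding instantaneous_current_def exit_rate_def
    by (rule sum.mono_neutral_left) (use v0 not_less_eq_eq in auto)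
  then have I: "instantaneous_current v L 0 \<eta> = (if \<eta> 0 = 1 then v (headway L \<eta> 0) else 0)" for \<eta>
    using exit_rate_eq[OF L] by simp
  have "stationary_current v y L N = (\<Sum>\<eta>\<in>configs_can L N. headway_weight y L \<eta> * instantaneous_current v L 0 \<eta>) / Z"
    unfolding stationary_current_def expectation_can_def headway_measure_can_def Z_def
    by (simp add: sum_divide_distrib)
  also have "(\<Sum>\<eta>\<in>configs_can L N. headway_weight y L \<eta> * instantaneous_current v L 0 \<eta>)
      = (\<Sum>\<eta>\<in>?\<Omega>. headway_weight y L \<eta> * v (headway L \<eta> 0))"
    unfolding I by (rule sum.mono_neutral_cong_right) (auto simp: finite_configs_can)
  finally have "stationary_current v y L N = w * (?F ^ N) $ (L - N - 1) / Z" unfolding C0 .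
  moreover have "Z = L / N * (?F ^ N) $ (L - N)"
    using partition_can_rooted[OF L, of N y] N unfolding Z0 Z_def by (simp add: field_simps)
  ultimately show ?thesis by simp
qed

subsection \<open>Exponential inequalities\<close>

text \<open>Strictness comes from the square in \<open>1 + z < (1 + z / 2)\<^sup>2\<close>; the rest
  is the non-strict inequality at \<open>z / 2\<close>.\<close>

lemma exp_gt_add_one_self:
  fixes z :: real
  assumes "z \<noteq> 0" shows "1 + z < exp z"
proof (cases "1 + z / 2 \<ge> 0")
  case True
  have "1 + z < (1 + z / 2)\<^sup>2" using zero_less_power2[of z] assms
    by (simp add: power2_eq_square algebra_simps)
  also have "\<dots> \<le> (exp (z / 2))\<^sup>2"
    using exp_ge_add_one_self[of "z / 2"] True by (intro power_mono) auto
  also have "\<dots> = exp z" by (simp add: power2_eq_square flip: exp_add)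
  finally show ?thesis .
next
  case False
  then have "1 + z < 0" by simp
  then show ?thesis using exp_gt_zero[of z] by linarith
qed

text \<open>For negative \<open>x\<close> the Taylor lower bound of \<open>exp (- x)\<close> is
  multiplied by \<open>1 + x + x\<^sup>2\<close>; the product is at least 1.\<close>

lemma exp_le_quadratic:
  fixes x :: real
  assumes "\<bar>x\<bar> \<le> 1" shows "exp x \<le> 1 + x + x\<^sup>2"
proof (cases "x \<ge> 0")
  case True
  then show ?thesis using assms exp_bound by simp
next
  case False
  define z where "z = - x"
  have z: "z \<ge> 0" using False by (simp add: z_def)
  have "1 + z + z\<^sup>2 / 2 \<le> exp z" using exp_lower_Taylor_quadratic[OF z] .
  moreover have "1 \<le> (1 - z + z\<^sup>2) * (1 + z + z\<^sup>2 / 2)"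
  proof -
    have "(1 - z + z\<^sup>2) * (1 + z + z\<^sup>2 / 2) = 1 + (z\<^sup>2 + z ^ 3 + z ^ 4) / 2"
      by (simp add: field_simps power2_eq_square power3_eq_cube power4_eq_xxxx)
    then show ?thesis using z by simp
  qed
  moreover have "0 < 1 - z + z\<^sup>2"
  proof -
    have "1 - z + z\<^sup>2 = (z - 1 / 2)\<^sup>2 + 3 / 4" by (simp add: power2_eq_square algebra_simps)
    then show ?thesis using zero_le_power2[of "z - 1 / 2"] by linarith
  qed
  ultimately have "1 \<le> (1 - z + z\<^sup>2) * exp z"
    by (meson less_imp_le mult_left_mono order_trans)
  then show ?thesis by (simp add: z_def exp_minus field_simps)
qed

text \<open>
  Jensen's inequality for \<open>exp (\<Sum>\<^sub>i h k\<^sub>i)\<close> over the compositions \<open>k\<^sub>1 + \<dots> + k\<^sub>N = M\<close> with weights \<open>\<Prod>\<^sub>i p k\<^sub>i\<close>,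
  as the tangent line \<open>exp x \<ge> exp m * (1 - m + x)\<close>; the second coefficient is the first moment of \<open>\<Sum>\<^sub>i h k\<^sub>i\<close>.
\<close>

lemma fps_power_exp_tilt_ge:
  fixes p h :: "nat \<Rightarrow> real"
  assumes p: "\<And>k. p k \<ge> 0"
  shows "exp m * ((1 - m) * (Abs_fps p ^ N) $ M + (of_nat N * Abs_fps p ^ (N - 1) * Abs_fps (\<lambda>k. p k * h k)) $ M)
    \<le> (Abs_fps (\<lambda>k. p k * exp (h k)) ^ N) $ M"
proof -
  define P where "P = Abs_fps p"
  define H where "H = Abs_fps (\<lambda>k. p k * h k)"
  define Q where "Q = Abs_fps (\<lambda>k. p k * exp (h k))"
  define B where "B = (\<lambda>N. of_nat N * P ^ (N - 1) * H)"
  have B_Suc: "B (Suc N) = P * B N + H * P ^ N" for N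
    by (cases N) (simp_all add: B_def algebra_simps)
  have "exp m * ((1 - m) * (P ^ N) $ M + B N $ M) \<le> (Q ^ N) $ M"
  proof (induction N arbitrary: m M)
    case 0
    have "1 - m \<le> exp (- m)" using exp_ge_add_one_self[of "- m"] by simp
    then have "exp m * (1 - m) \<le> 1" by (simp add: exp_minus field_simps)
    then show ?case by (simp add: B_def)
  next
    case (Suc N)
    have "exp m * ((1 - m) * (P ^ Suc N) $ M + B (Suc N) $ M)
      = exp m * ((1 - m) * (P * P ^ N) $ M + ((P * B N) $ M + (H * P ^ N) $ M))"
      by (simp add: B_Suc)
    \<comment> \<open>Splitting off the first part \<open>i\<close> removes \<open>h i\<close> from
      the total, so the induction hypothesis is applied at \<open>m - h i\<close>; this is why
      \<open>m\<close> is arbitrary in the induction.\<close>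
    also have "\<dots> = (\<Sum>i=0..M. p i * exp m * ((1 - (m - h i)) * (P ^ N) $ (M - i) + B N $ (M - i)))"
      unfolding fps_mult_nth sum_distrib_left sum.distrib[symmetric]
      by (rule sum.cong) (simp_all add: P_def H_def algebra_simps)
    also have "\<dots> \<le> (\<Sum>i=0..M. p i * (exp (h i) * (Q ^ N) $ (M - i)))"
    proof (rule sum_mono)
      fix i
      have "exp m * ((1 - (m - h i)) * (P ^ N) $ (M - i) + B N $ (M - i))
         = exp (h i) * (exp (m - h i) * ((1 - (m - h i)) * (P ^ N) $ (M - i) + B N $ (M - i)))"
        by (simp add: exp_diff)
      also have "\<dots> \<le> exp (h i) * (Q ^ N) $ (M - i)"
        by (rule mult_left_mono[OF Suc.IH]) simp
      finally show "p i * exp m * ((1 - (m - h i)) * (P ^ N) $ (M - i) + B N $ (M - i))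
          \<le> p i * (exp (h i) * (Q ^ N) $ (M - i))"
        unfolding mult.assoc by (rule mult_left_mono) (rule p)
    qed
    also have "\<dots> = (Q ^ Suc N) $ M"
      unfolding power_Suc fps_mult_nth by (simp add: Q_def mult.assoc)
    finally show ?case .
  qed
  then show ?thesis unfolding B_def P_def H_def Q_def .
qed

text \<open>Chernoff bound: all terms being non-negative, a single coefficient weighted by
  \<open>u ^ M\<close> is at most the \<open>N\<close>-th power of a bound for the whole series.
  Only partial sums enter, so no convergence has to be established.\<close>

lemma fps_power_nth_le:
  fixes p :: "nat \<Rightarrow> real"
  assumes p: "\<And>k. p k \<ge> 0" and u: "u \<ge> 0" and S: "\<And>n. (\<Sum>k=0..n. p k * u ^ k) \<le> S"
  shows "(Abs_fps p ^ N) $ M * u ^ M \<le> S ^ N"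
proof (induction N arbitrary: M)
  case 0
  then show ?case by simp
next
  case (Suc N)
  have S0: "S \<ge> 0" using S[of 0] p[of 0] by simp
  have "(Abs_fps p ^ Suc N) $ M * u ^ M
      = (\<Sum>i=0..M. (p i * u ^ i) * ((Abs_fps p ^ N) $ (M - i) * u ^ (M - i)))"
    unfolding power_Suc fps_mult_nth sum_distrib_right
    by (rule sum.cong) (simp_all add: power_add[symmetric] mult.assoc mult.left_commute)
  also have "\<dots> \<le> (\<Sum>i=0..M. (p i * u ^ i) * S ^ N)"
    by (intro sum_mono mult_left_mono Suc.IH mult_nonneg_nonneg p zero_le_power u)
  also have "\<dots> \<le> S * S ^ N"
    unfolding sum_distrib_right[symmetric] by (rule mult_right_mono[OF S]) (simp add: S0)
  finally show ?case by simp
qed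

subsection \<open>The generating function\<close>

locale headway_series =
  fixes y :: "nat \<Rightarrow> real" and C :: real
  assumes y_0: "y 0 = 0" and y_pos: "1 \<le> k \<Longrightarrow> 0 < y k"
    and ratio: "y n \<le> C * y (n + 1)" and radius: "conv_radius (\<lambda>k. y (k + 1)) > 0"
begin

definition P :: "real fps" where "P = Abs_fps (\<lambda>k. y (k + 1))"

lemma P_nth [simp]: "P $ k = y (Suc k)" by (simp add: P_def)

lemma y_Suc_pos [simp]: "0 < y (Suc k)" by (simp add: y_pos)

lemma y_Suc_nonzero [simp]: "y (Suc k) \<noteq> 0" using y_Suc_pos[of k] by linarith

lemma C_pos: "C > 0"
proof -
  have "0 < C * y 2" using less_le_trans[OF y_pos[of 1] ratio[of 1]] by (simp add: numeral_2_eq_2)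
  then show ?thesis using y_pos[of 2] by (simp add: zero_less_mult_iff)
qed

text \<open>Iterating \<open>ratio\<close> gives \<open>y 1 \<le> C ^ n * y (n + 1)\<close>, so the
  terms of the series at \<open>C\<close> do not tend to 0. Hence the radius is finite and
  \<open>u_crit y\<close> represents it faithfully.\<close>

lemma radius_le: "conv_radius (\<lambda>k. y (k + 1)) \<le> C"
proof (rule ccontr)
  have ge: "y 1 \<le> C ^ n * y (Suc n)" for n
  proof (induction n)
    case (Suc n)
    have "C ^ n * y (Suc n) \<le> C ^ n * (C * y (Suc (Suc n)))"
      using ratio[of "Suc n"] C_pos by (intro mult_left_mono) auto
    with Suc show ?case by (simp add: mult_ac)
  qed simp
  assume "\<not> conv_radius (\<lambda>k. y (k + 1)) \<le> C"
  then have "summable (\<lambda>n. y (n + 1) * C ^ n)"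
    using C_pos by (intro summable_in_conv_radius) auto
  then have "(\<lambda>n. y (n + 1) * C ^ n) \<longlonglongrightarrow> 0" by (rule summable_LIMSEQ_zero)
  moreover have "\<forall>n. y 1 \<le> y (n + 1) * C ^ n" using ge by (simp add: mult.commute)
  ultimately have "y 1 \<le> 0" by (intro LIMSEQ_le_const) auto
  then show False using y_pos[OF order_refl] by linarith
qed

lemma ereal_u_crit: "ereal (u_crit y) = conv_radius (\<lambda>k. y (k + 1))"
  unfolding u_crit_def using radius radius_le
  by (cases "conv_radius (\<lambda>k. y (k + 1))") auto

lemma u_crit_pos: "u_crit y > 0" and u_crit_le: "u_crit y \<le> C"
  using radius radius_le unfolding ereal_u_crit[symmetric] by simp_all

lemma fps_conv_radius_P: "fps_conv_radius P = ereal (u_crit y)"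
  unfolding ereal_u_crit fps_conv_radius_def by simp

lemma gen_fun_eq: "gen_fun y u = eval_fps P u"
  unfolding gen_fun_def eval_fps_def by (simp add: mult.commute)

lemma gen_fun_sums:
  assumes "\<bar>u\<bar> < u_crit y" shows "(\<lambda>k. y (k + 1) * u ^ k) sums gen_fun y u"
  using sums_eval_fps[of u P] assms by (simp add: gen_fun_eq fps_conv_radius_P)

lemma gen_fun_pos:
  assumes "0 \<le> u" "u < u_crit y" shows "gen_fun y u > 0"
proof -
  have s: "(\<lambda>k. y (k + 1) * u ^ k) sums gen_fun y u" using gen_fun_sums assms by simp
  have "(\<Sum>k\<in>{0}. y (k + 1) * u ^ k) \<le> (\<Sum>k. y (k + 1) * u ^ k)"
    by (rule sum_le_suminf) (use sums_summable[OF s] assms in \<open>auto simp: less_imp_le\<close>)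
  then show ?thesis using sums_unique[OF s] less_le_trans[OF y_Suc_pos[of 0]] by simp
qed

lemma P_power_nonneg: "(P ^ N) $ M \<ge> 0"
proof (induction N arbitrary: M)
  case (Suc N)
  then show ?case by (auto simp: fps_mult_nth intro!: sum_nonneg simp: less_imp_le)
qed simp

lemma P_power_pos:
  assumes "N \<ge> 1" shows "(P ^ N) $ M > 0"
  using assms
proof (induction N arbitrary: M rule: dec_induct)
  case (step N)
  have "y (Suc 0) * (P ^ N) $ M \<le> (\<Sum>i=0..M. P $ i * (P ^ N) $ (M - i))"
    using member_le_sum[of 0 "{0..M}" "\<lambda>i. P $ i * (P ^ N) $ (M - i)"] P_power_nonneg
    by (simp add: less_imp_le)
  moreover have "0 < y (Suc 0) * (P ^ N) $ M" using step.IH[of M] by simp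
  ultimately show ?case by (simp add: fps_mult_nth)
qed simp

section \<open>Exponential moments of the ratios \<open>y k / y (k + 1)\<close>\<close>

text \<open>For \<open>u \<ge> 0\<close>, division by \<open>gen_fun y u\<close> shows that
  \<open>y k / y (k + 1)\<close> has mean \<open>u\<close> under the grand canonical law with
  fugacity \<open>u\<close>.\<close>

lemma y_power_sums:
  assumes "\<bar>u\<bar> < u_crit y" shows "(\<lambda>k. y k * u ^ k) sums (u * gen_fun y u)"
proof -
  have "(\<lambda>k. u * (y (k + 1) * u ^ k)) sums (u * gen_fun y u)"
    by (rule sums_mult[OF gen_fun_sums[OF assms]])
  then have "(\<lambda>k. y (Suc k) * u ^ Suc k) sums (u * gen_fun y u)" by (simp add: mult_ac)
  then show ?thesis by (subst (asm) sums_Suc_iff) (simp add: y_0)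
qed

text \<open>The variable \<open>y k / y (k + 1)\<close> has mean \<open>u\<close> and lies between 0
  and \<open>C\<close>, so its exponential moment is bounded by \<open>exp_le_quadratic\<close>
  applied termwise, followed by \<open>1 + x \<le> exp x\<close>.\<close>

lemma tilted_sum_le:
  assumes u: "0 \<le> u" "u < u_crit y" and s: "\<bar>s\<bar> * C \<le> 1"
  shows "(\<Sum>k=0..n. y (k + 1) * exp (s * (y k / y (k + 1))) * u ^ k)
    \<le> gen_fun y u * exp (s * u + s\<^sup>2 * C\<^sup>2)"
proof -
  define r where "r = (\<lambda>k. (1 + s\<^sup>2 * C\<^sup>2) * (y (k + 1) * u ^ k) + s * (y k * u ^ k))"
  have r: "r sums ((1 + s\<^sup>2 * C\<^sup>2) * gen_fun y u + s * (u * gen_fun y u))"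
    unfolding r_def using u by (intro sums_add sums_mult gen_fun_sums y_power_sums) auto
  have le: "y (k + 1) * exp (s * (y k / y (k + 1))) * u ^ k \<le> r k" for k
  proof -
    define g where "g = y k / y (k + 1)"
    have y0: "y k \<ge> 0" using y_0 y_pos[of k] by (cases "k = 0") auto
    have g: "0 \<le> g" "g \<le> C" using ratio[of k] y0 by (auto simp: g_def divide_simps)
    have "\<bar>s\<bar> * g \<le> \<bar>s\<bar> * C" by (rule mult_left_mono) (use g in auto)
    then have "\<bar>s * g\<bar> \<le> 1" using s g by (simp add: abs_mult)
    then have "exp (s * g) \<le> 1 + s * g + (s * g)\<^sup>2" by (rule exp_le_quadratic)
    also have "(s * g)\<^sup>2 \<le> s\<^sup>2 * C\<^sup>2"
      unfolding power_mult_distrib using g by (intro mult_left_mono power_mono) auto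
    finally have "exp (s * g) \<le> 1 + s * g + s\<^sup>2 * C\<^sup>2" by simp
    then have "y (k + 1) * exp (s * g) * u ^ k \<le> y (k + 1) * (1 + s * g + s\<^sup>2 * C\<^sup>2) * u ^ k"
      using u by (intro mult_right_mono mult_left_mono) (auto simp: less_imp_le)
    also have "y (k + 1) * (1 + s * g + s\<^sup>2 * C\<^sup>2) = (1 + s\<^sup>2 * C\<^sup>2) * y (k + 1) + s * y k"
      by (simp add: g_def algebra_simps)
    finally show ?thesis by (simp add: g_def r_def algebra_simps)
  qed
  have r0: "r k \<ge> 0" for k
    by (rule order_trans[OF _ le]) (use u in \<open>auto simp: less_imp_le\<close>)
  have "(\<Sum>k=0..n. y (k + 1) * exp (s * (y k / y (k + 1))) * u ^ k) \<le> (\<Sum>k=0..n. r k)"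
    by (rule sum_mono) (rule le)
  also have "\<dots> \<le> suminf r"
    by (rule sum_le_suminf) (use r r0 in \<open>auto simp: sums_iff\<close>)
  also have "\<dots> = gen_fun y u * (1 + (s * u + s\<^sup>2 * C\<^sup>2))"
    using r by (simp add: sums_iff algebra_simps)
  also have "\<dots> \<le> gen_fun y u * exp (s * u + s\<^sup>2 * C\<^sup>2)"
    using gen_fun_pos[OF u] by (intro mult_left_mono exp_ge_add_one_self) auto
  finally show ?thesis .
qed

text \<open>
  The logarithm of the probability that \<open>N\<close> independent headways with grand canonical law
  \<open>k \<mapsto> y (k + 1) * u ^ k / gen_fun y u\<close> add up to \<open>M\<close>.
\<close>

definition log_prob :: "real \<Rightarrow> nat \<Rightarrow> nat \<Rightarrow> real" where
  "log_prob u N M = ln ((P ^ N) $ M) + M * ln u - N * ln (gen_fun y u)"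

lemma exp_log_prob:
  assumes "0 < u" "u < u_crit y" "N \<ge> 1"
  shows "exp (log_prob u N M) = (P ^ N) $ M * u ^ M / gen_fun y u ^ N"
  using assms gen_fun_pos[of u] P_power_pos[OF assms(3), of M]
  unfolding log_prob_def exp_diff exp_add exp_of_nat_mult by simp

text \<open>The exponential moment of the summed ratios, conditioned on total headway
  \<open>M\<close>, is bounded below by Jensen's inequality and above by the unconditioned moment
  divided by the probability of the condition. The claim compares the logarithms.\<close>

lemma current_exponential_bound:
  assumes u: "0 < u" "u < u_crit y" and s: "\<bar>s\<bar> * C \<le> 1" and N: "N \<ge> 1" and M: "M \<ge> 1"
  shows "N * (s * ((P ^ N) $ (M - 1) / (P ^ N) $ M)) \<le> N * (s * u + s\<^sup>2 * C\<^sup>2) - log_prob u N M"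
proof -
  define R where "R = (P ^ N) $ (M - 1) / (P ^ N) $ M"
  \<comment> \<open>The conditional mean of the sum of the values \<open>h\<close>. With this choice
    the factor of \<open>exp m\<close> in \<open>fps_power_exp_tilt_ge\<close> reduces to
    \<open>(P ^ N) $ M\<close>.\<close>
  define m where "m = N * s * R"
  define h where "h = (\<lambda>k. s * (y k / y (k + 1)))"
  define Q where "Q = Abs_fps (\<lambda>k. y (k + 1) * exp (h k))"
  have A: "(P ^ N) $ M > 0" by (rule P_power_pos[OF N])
  have H: "Abs_fps (\<lambda>k. y (k + 1) * h k) = fps_const s * (fps_X * P)"
  proof (rule fps_ext)
    fix k
    have "y (k + 1) * h k = s * y k" by (simp add: h_def)
    then show "Abs_fps (\<lambda>k. y (k + 1) * h k) $ k = (fps_const s * (fps_X * P)) $ k"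
      by (cases k) (simp_all add: y_0)
  qed
  have BH: "of_nat N * P ^ (N - 1) * (fps_const s * (fps_X * P)) = fps_const (N * s) * (fps_X * P ^ N)"
    using N by (cases N) (simp_all add: fps_of_nat[symmetric] algebra_simps)
  have B: "(of_nat N * P ^ (N - 1) * Abs_fps (\<lambda>k. y (k + 1) * h k)) $ M = N * s * (P ^ N) $ (M - 1)"
    unfolding H BH using M by simp
  have "exp m * (P ^ N) $ M = exp m * ((1 - m) * (P ^ N) $ M + N * s * (P ^ N) $ (M - 1))"
    using A by (simp add: m_def R_def field_simps)
  also have "\<dots> \<le> (Q ^ N) $ M"
    using fps_power_exp_tilt_ge[of "\<lambda>k. y (k + 1)" m N M h] B
    unfolding P_def[symmetric] Q_def by (simp add: less_imp_le)
  finally have "exp m * (P ^ N) $ M * u ^ M \<le> (Q ^ N) $ M * u ^ M"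
    using u by (intro mult_right_mono) auto
  also have "\<dots> \<le> (gen_fun y u * exp (s * u + s\<^sup>2 * C\<^sup>2)) ^ N"
    unfolding Q_def h_def
    by (rule fps_power_nth_le) (use u tilted_sum_le[OF _ u(2) s] in \<open>auto simp: less_imp_le\<close>)
  also have "\<dots> = gen_fun y u ^ N * exp (N * (s * u + s\<^sup>2 * C\<^sup>2))"
    by (simp only: power_mult_distrib exp_of_nat_mult)
  finally have "exp m * ((P ^ N) $ M * u ^ M / gen_fun y u ^ N) \<le> exp (N * (s * u + s\<^sup>2 * C\<^sup>2))"
    using gen_fun_pos[of u] u by (simp add: field_simps)
  then have "exp (m + log_prob u N M) \<le> exp (N * (s * u + s\<^sup>2 * C\<^sup>2))"
    unfolding exp_add exp_log_prob[OF u N] .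
  then show ?thesis by (simp add: m_def R_def algebra_simps)
qed

section \<open>The mean headway as a function of the fugacity\<close>

lemma mean_headway_eq:
  assumes "0 < u" "u < u_crit y"
  shows "mean_headway y u = u * eval_fps (fps_deriv P) u / eval_fps P u"
proof -
  have "(eval_fps P has_field_derivative eval_fps (fps_deriv P) u) (at u)"
    by (rule has_field_derivative_eval_fps) (use assms in \<open>simp add: fps_conv_radius_P\<close>)
  moreover have "eval_fps P u > 0" using gen_fun_pos[of u] assms by (simp add: gen_fun_eq)
  ultimately have "((\<lambda>v. ln (eval_fps P v)) has_field_derivative 1 / eval_fps P u * eval_fps (fps_deriv P) u) (at u)"
    by (intro DERIV_chain2[OF DERIV_ln_divide])
  then show ?thesis
    unfolding mean_headway_def gen_fun_eq by (simp add: DERIV_imp_deriv)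
qed

text \<open>Identifies \<open>mean_headway y u\<close> as the mean of the grand canonical law; the
  series is \<open>u\<close> times the derivative of \<open>gen_fun y\<close> at
  \<open>u\<close>.\<close>

lemma headway_moment_sums:
  assumes u: "0 < u" "u < u_crit y"
  shows "(\<lambda>k. k * (y (k + 1) * u ^ k)) sums (mean_headway y u * gen_fun y u)"
proof -
  have "(\<lambda>n. fps_deriv P $ n * u ^ n) sums eval_fps (fps_deriv P) u"
    by (rule sums_eval_fps, rule less_le_trans[OF _ fps_conv_radius_deriv])
      (use u in \<open>simp add: fps_conv_radius_P\<close>)
  then have "(\<lambda>n. u * (fps_deriv P $ n * u ^ n)) sums (u * eval_fps (fps_deriv P) u)"
    by (rule sums_mult)
  also have "(\<lambda>n. u * (fps_deriv P $ n * u ^ n)) = (\<lambda>n. Suc n * (y (Suc n + 1) * u ^ Suc n))"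
    by (simp add: fun_eq_iff mult_ac)
  finally have "(\<lambda>k. k * (y (k + 1) * u ^ k)) sums (u * eval_fps (fps_deriv P) u)"
    by (subst (asm) sums_Suc_iff) simp
  moreover have "mean_headway y u * gen_fun y u = u * eval_fps (fps_deriv P) u"
    using gen_fun_pos[of u] u unfolding mean_headway_eq[OF u] gen_fun_eq by simp
  ultimately show ?thesis by simp
qed

lemma mean_headway_pos:
  assumes u: "0 < u" "u < u_crit y"
  shows "mean_headway y u > 0"
proof -
  note s = headway_moment_sums[OF u]
  have "0 < (\<Sum>k. k * (y (k + 1) * u ^ k))"
    by (rule suminf_pos2[where i = 1]) (use s u in \<open>auto simp: sums_iff less_imp_le\<close>)
  then show ?thesis
    using gen_fun_pos[of u] u s by (simp add: sums_iff zero_less_mult_iff)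
qed

text \<open>\<open>x \<mapsto> ln (gen_fun y (exp x))\<close> is strictly convex with derivative \<open>mean_headway y (exp x)\<close>.\<close>

lemma gen_fun_tangent:
  assumes u: "0 < u" "u < u_crit y" and v: "0 < v" "v < u_crit y" and ne: "u \<noteq> v"
  shows "gen_fun y v * (u / v) powr mean_headway y v < gen_fun y u"
proof -
  define m where "m = mean_headway y v"
  define x where "x = ln (u / v)"
  define d where "d = (\<lambda>k. y (k + 1) * u ^ k - exp (m * x) * ((1 - m * x) * (y (k + 1) * v ^ k) + x * (k * (y (k + 1) * v ^ k))))"
  have m: "m > 0" unfolding m_def by (rule mean_headway_pos[OF v])
  have x: "x \<noteq> 0" using u v ne by (simp add: x_def)
  have pow: "u ^ k = v ^ k * exp (k * x)" for k
    using u v by (simp add: x_def exp_of_nat_mult power_divide)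
  have d: "d k = y (k + 1) * v ^ k * exp (m * x) * (exp (k * x - m * x) - (1 + (k * x - m * x)))" for k
    unfolding d_def pow by (simp add: exp_diff field_simps)
  \<comment> \<open>The term \<open>k = 0\<close> gives strictness, because its argument
    \<open>- m * x\<close> is non-zero.\<close>
  have d0: "d 0 > 0"
    unfolding d using exp_gt_add_one_self[of "- m * x"] m x v by simp
  have dk: "d k \<ge> 0" for k
    unfolding d using exp_ge_add_one_self[of "k * x - m * x"] v
    by (intro mult_nonneg_nonneg) (auto simp: less_imp_le)
  have s: "d sums (gen_fun y u - exp (m * x) * ((1 - m * x) * gen_fun y v + x * (m * gen_fun y v)))"
    unfolding d_def m_def using u v
    by (intro sums_diff sums_mult sums_add gen_fun_sums headway_moment_sums) auto
  have "0 < suminf d"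
    by (rule suminf_pos2[where i = 0]) (use s d0 dk in \<open>auto simp: sums_iff\<close>)
  then have "gen_fun y v * exp (m * x) < gen_fun y u"
    using s by (simp add: sums_iff algebra_simps)
  moreover have "(u / v) powr m = exp (m * x)" using u v by (simp add: powr_def x_def)
  ultimately show ?thesis by (simp add: m_def)
qed

text \<open>The tangent inequalities at \<open>u\<close> and at \<open>v\<close> are combined; the
  values of \<open>gen_fun y\<close> cancel and leave
  \<open>(v / u) powr a < (v / u) powr b\<close>.\<close>

lemma mean_headway_strict_mono:
  assumes "0 < u" "u < v" "v < u_crit y"
  shows "mean_headway y u < mean_headway y v"
proof -
  define a b where "a = mean_headway y u" and "b = mean_headway y v"
  have v: "0 < v" and u: "u < u_crit y" using assms by auto
  have F: "gen_fun y u > 0" using gen_fun_pos[of u] assms by simp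
  have 1: "gen_fun y v * (u / v) powr b < gen_fun y u"
    unfolding b_def using gen_fun_tangent[of u v] assms by simp
  have 2: "gen_fun y u * (v / u) powr a < gen_fun y v"
    unfolding a_def using gen_fun_tangent[of v u] assms by simp
  have "(gen_fun y u * (v / u) powr a) * (u / v) powr b < gen_fun y v * (u / v) powr b"
    by (rule mult_strict_right_mono[OF 2]) (use assms in simp)
  then have "gen_fun y u * ((v / u) powr a * (u / v) powr b) < gen_fun y u * 1"
    using 1 by simp
  then have "(v / u) powr a * (u / v) powr b < 1" using F by (simp only: mult_less_cancel_left_pos)
  moreover have "(u / v) powr b = inverse ((v / u) powr b)"
    using assms v by (simp add: powr_divide)
  ultimately have "(v / u) powr a < (v / u) powr b"
    using assms v by (simp add: field_simps)
  then show ?thesis using assms v unfolding a_def b_def by (subst (asm) powr_less_cancel_iff) auto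
qed

lemma mean_headway_mono:
  "0 < u \<Longrightarrow> u \<le> v \<Longrightarrow> v < u_crit y \<Longrightarrow> mean_headway y u \<le> mean_headway y v"
  using mean_headway_strict_mono[of u v] by (cases "u = v") auto

text \<open>The quotient \<open>H\<close> is continuous up to 0, where the factor \<open>u\<close>
  makes it vanish.\<close>

lemma mean_headway_IVT:
  assumes t: "0 < t" and v: "0 < v" "v < u_crit y" "t < mean_headway y v"
  obtains u where "0 < u" "u < v" "mean_headway y u = t"
proof -
  define H where "H = (\<lambda>u. u * eval_fps (fps_deriv P) u / eval_fps P u)"
  have c: "continuous_on {0..v} H"
  proof -
    have "{0..v} \<subseteq> eball 0 (fps_conv_radius P)"
      using v by (auto simp: fps_conv_radius_P)
    moreover have "eball 0 (fps_conv_radius P) \<subseteq> eball 0 (fps_conv_radius (fps_deriv P))"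
      by (rule eball_mono) (rule fps_conv_radius_deriv)
    ultimately have "continuous_on {0..v} (eval_fps P)" "continuous_on {0..v} (eval_fps (fps_deriv P))"
      by (blast intro: continuous_on_subset[OF continuous_on_eval_fps])+
    moreover have "\<forall>u\<in>{0..v}. eval_fps P u \<noteq> 0"
      using gen_fun_pos v unfolding gen_fun_eq by force
    ultimately show ?thesis unfolding H_def
      by (intro continuous_on_divide continuous_on_mult continuous_on_id)
  qed
  have "H 0 \<le> t" "t \<le> H v" using t v mean_headway_eq[of v] by (simp_all add: H_def)
  then obtain u where u: "0 \<le> u" "u \<le> v" "H u = t" using IVT'[of H 0 t v] c v by auto
  have "u \<noteq> 0" using u t by (auto simp: H_def)
  moreover have "u \<noteq> v" using u v mean_headway_eq[of v] by (auto simp: H_def)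
  ultimately show ?thesis using that[of u] u v mean_headway_eq[of u] by (auto simp: H_def)
qed

subsection \<open>Large deviation bounds for the total headway\<close>

lemma P_power_sums:
  assumes "0 \<le> u" "u < u_crit y"
  shows "(\<lambda>M. (P ^ N) $ M * u ^ M) sums (gen_fun y u ^ N)"
proof -
  have u: "norm u < fps_conv_radius P" using assms by (simp add: fps_conv_radius_P)
  have "(\<lambda>M. (P ^ N) $ M * u ^ M) sums eval_fps (P ^ N) u"
    by (rule sums_eval_fps, rule less_le_trans[OF u fps_conv_radius_power])
  then show ?thesis using eval_fps_power[OF u] by (simp add: gen_fun_eq)
qed

text \<open>
  Tilting the law from \<open>u\<close> to \<open>u1\<close> or \<open>u2\<close> (Chernoff bound) shows that the total headway leaves the window
  with exponentially small probability.
\<close>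

lemma window_bound:
  assumes u1: "0 < u1" "u1 < u" and u2: "u < u2" "u2 < u_crit y"
  shows "\<forall>\<^sub>F N in sequentially. \<exists>M. mean_headway y u1 * real N < real M \<and> real M < mean_headway y u2 * real N
    \<and> gen_fun y u ^ N / (2 * (mean_headway y u2 * real N + 1)) \<le> (P ^ N) $ M * u ^ M"
proof -
  define F where "F = gen_fun y"
  define r1 r2 where "r1 = mean_headway y u1" and "r2 = mean_headway y u2"
  define q1 q2 where "q1 = F u1 * (u / u1) powr r1 / F u" and "q2 = F u2 * (u / u2) powr r2 / F u"
  have u: "0 < u" "u < u_crit y" using assms by auto
  have Fp: "F u > 0" "F u1 > 0" "F u2 > 0" unfolding F_def by (rule gen_fun_pos; use assms u in linarith)+
  have r2: "r2 > 0" unfolding r2_def using mean_headway_pos assms u by simp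
  have q: "0 \<le> q1" "q1 < 1" "0 \<le> q2" "q2 < 1"
    using gen_fun_tangent[of u u1] gen_fun_tangent[of u u2] Fp assms u
    by (simp_all add: q1_def q2_def r1_def r2_def F_def less_imp_le)
  have "(\<lambda>N. q1 ^ N) \<longlonglongrightarrow> 0" "(\<lambda>N. q2 ^ N) \<longlonglongrightarrow> 0"
    using q by (auto intro!: LIMSEQ_power_zero)
  \<comment> \<open>Two tails of less than 1/4 each leave more than half of the mass in the
    window.\<close>
  then have "\<forall>\<^sub>F N in sequentially. q1 ^ N < 1 / 4" "\<forall>\<^sub>F N in sequentially. q2 ^ N < 1 / 4"
    using order_tendstoD(2)[of _ 0 sequentially "1 / 4 :: real"] by auto
  then show ?thesis
  proof eventually_elim
    case (elim N)
    define T where "T = (\<lambda>v M. (P ^ N) $ M * v ^ M)"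
    define W where "W = {M. r1 * real N < real M \<and> real M < r2 * real N}"
    define B where "B = F u ^ N / (2 * (r2 * real N + 1))"
    define c1 c2 where "c1 = (u / u1) powr (r1 * N)" and "c2 = (u / u2) powr (r2 * N)"
    have W: "W \<subseteq> {..<nat \<lceil>r2 * real N\<rceil>}"
      unfolding W_def by (auto simp: less_ceiling_iff nat_less_iff zless_nat_eq_int_zless)
    have fW: "finite W" by (rule finite_subset[OF W]) simp
    have "real (card W) \<le> real (nat \<lceil>r2 * real N\<rceil>)"
      using card_mono[OF _ W] by simp
    also have "\<dots> \<le> r2 * real N + 1" using r2 by (simp add: of_nat_nat)
    finally have cW: "real (card W) \<le> r2 * real N + 1" .
    have T0: "T v M \<ge> 0" if "v > 0" for v M using that P_power_nonneg by (simp add: T_def)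
    have le: "T u M \<le> (if M \<in> W then T u M else 0) + c1 * T u1 M + c2 * T u2 M" for M
    proof -
      have c: "0 \<le> c1 * T u1 M" "0 \<le> c2 * T u2 M" using T0 assms u by (auto simp: c1_def c2_def)
      have eq: "T u M = (u / v) powr real M * T v M" if "v > 0" for v
        using that u by (simp add: T_def powr_realpow power_divide)
      consider "M \<in> W" | "real M \<le> r1 * real N" | "r2 * real N \<le> real M"
        unfolding W_def by force
      then show ?thesis
      proof cases
        case 2
        then have "(u / u1) powr real M \<le> c1" unfolding c1_def by (intro powr_mono) (use assms in auto)
        then have "T u M \<le> c1 * T u1 M"
          unfolding eq[OF u1(1)] using T0[OF u1(1)] by (intro mult_right_mono) auto
        then show ?thesis using c T0[OF u(1)] by auto
      next
        case 3
        then have "(u / u2) powr real M \<le> c2" unfolding c2_def by (intro powr_mono') (use assms u in auto)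
        moreover have "u2 > 0" using u u2 by simp
        ultimately have "T u M \<le> c2 * T u2 M"
          using T0 eq by (metis mult_right_mono)
        then show ?thesis using c T0[OF u(1)] by auto
      qed (use c in simp)
    qed
    have "(\<lambda>M. (if M \<in> W then T u M else 0) + c1 * T u1 M + c2 * T u2 M)
        sums ((\<Sum>M\<in>W. T u M) + c1 * F u1 ^ N + c2 * F u2 ^ N)"
      unfolding T_def F_def using assms u
      by (intro sums_add sums_mult sums_If_finite_set fW P_power_sums) auto
    moreover have "T u sums (F u ^ N)"
      unfolding T_def F_def using u by (intro P_power_sums) auto
    ultimately have "F u ^ N \<le> (\<Sum>M\<in>W. T u M) + c1 * F u1 ^ N + c2 * F u2 ^ N"
      by (rule sums_le[OF le, rotated])
    moreover have "c1 * F u1 ^ N = q1 ^ N * F u ^ N" "c2 * F u2 ^ N = q2 ^ N * F u ^ N"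
    proof -
      have "c1 = ((u / u1) powr r1) ^ N" "c2 = ((u / u2) powr r2) ^ N"
        using u u1 u2 by (simp_all add: c1_def c2_def powr_power mult.commute)
      moreover have "F u1 * (u / u1) powr r1 = q1 * F u" "F u2 * (u / u2) powr r2 = q2 * F u"
        using Fp by (simp_all add: q1_def q2_def)
      ultimately show "c1 * F u1 ^ N = q1 ^ N * F u ^ N" "c2 * F u2 ^ N = q2 ^ N * F u ^ N"
        by (metis power_mult_distrib mult.commute)+
    qed
    moreover have "q1 ^ N * F u ^ N < 1 / 4 * F u ^ N" "q2 ^ N * F u ^ N < 1 / 4 * F u ^ N"
      using elim Fp by (intro mult_strict_right_mono; simp)+
    ultimately have half: "F u ^ N / 2 < (\<Sum>M\<in>W. T u M)" by simp
    \<comment> \<open>Pigeonhole: the window has at most \<open>r2 * real N + 1\<close> points, so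
      one of them carries mass at least \<open>B\<close>.\<close>
    have "\<exists>M\<in>W. B \<le> T u M"
    proof (rule ccontr)
      assume "\<not> (\<exists>M\<in>W. B \<le> T u M)"
      then have "(\<Sum>M\<in>W. T u M) \<le> card W * B"
        by (intro sum_bounded_above) (auto simp: not_le less_imp_le)
      also have "\<dots> \<le> (r2 * real N + 1) * B"
        using cW Fp r2 by (intro mult_right_mono) (auto simp: B_def)
      also have "\<dots> = F u ^ N / 2"
      proof -
        have "r2 * real N + 1 > 0" using r2 by (simp add: add_nonneg_pos)
        moreover have "a * (X / (2 * a)) = X / 2" if "a > 0" for a X :: real
          using that by simp
        ultimately show ?thesis unfolding B_def by blast
      qed
      finally show False using half by simp
    qed
    then show ?case unfolding W_def B_def T_def r1_def r2_def F_def by auto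
  qed
qed

section \<open>Cost of enlarging the total headway\<close>

text \<open>Lengthening one of the \<open>N\<close> gaps by one site changes its weight by a factor
  of at least \<open>1 / C\<close>.\<close>

lemma P_power_step:
  assumes "N \<ge> 1" shows "(P ^ N) $ M \<le> C * (P ^ N) $ Suc M"
proof -
  obtain n where n: "N = Suc n" using assms by (cases N) auto
  have "(P ^ N) $ M = (fps_X * P * P ^ n) $ Suc M" by (simp add: n mult.assoc)
  also have "\<dots> = (\<Sum>i=0..Suc M. y i * (P ^ n) $ (Suc M - i))"
    unfolding fps_mult_nth[of "fps_X * P"] by (rule sum.cong) (auto simp: y_0 gr0_conv_Suc)
  also have "\<dots> \<le> (\<Sum>i=0..Suc M. C * y (i + 1) * (P ^ n) $ (Suc M - i))"
    by (intro sum_mono mult_right_mono ratio P_power_nonneg)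
  also have "\<dots> = C * (P ^ N) $ Suc M"
    unfolding n power_Suc fps_mult_nth sum_distrib_left by (rule sum.cong) simp_all
  finally show ?thesis .
qed

lemma P_power_steps:
  assumes "N \<ge> 1" shows "(P ^ N) $ M \<le> C ^ k * (P ^ N) $ (M + k)"
proof (induction k)
  case (Suc k)
  have "C ^ k * (P ^ N) $ (M + k) \<le> C ^ k * (C * (P ^ N) $ Suc (M + k))"
    using P_power_step[OF assms] C_pos by (intro mult_left_mono) auto
  with Suc show ?case by (simp add: mult_ac)
qed simp

text \<open>\<open>window_bound\<close> supplies a likely total \<open>M'\<close> below
  \<open>mean_headway y u2 * N\<close>, hence below \<open>M\<close>. Per unit of the way up to
  \<open>M\<close> the coefficient loses at most a factor \<open>C\<close> and the power of
  \<open>u\<close> contributes a factor \<open>u\<close>, which makes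
  \<open>ln (C / u)\<close>.\<close>

lemma log_prob_lower:
  assumes u1: "0 < u1" "u1 < u" and u2: "u < u2" "u2 < u_crit y"
  shows "\<forall>\<^sub>F N in sequentially. \<forall>M. mean_headway y u2 * real N \<le> real M \<longrightarrow>
    - (real M - mean_headway y u1 * real N) * ln (C / u) - ln (2 * (mean_headway y u2 * real N + 1)) \<le> log_prob u N M"
  using window_bound[OF assms] eventually_ge_at_top[of 1]
proof eventually_elim
  case (elim N)
  define r1 r2 where "r1 = mean_headway y u1" and "r2 = mean_headway y u2"
  define D where "D = 2 * (r2 * real N + 1)"
  have u: "0 < u" "u < u_crit y" using assms by auto
  have r2: "r2 > 0" unfolding r2_def using mean_headway_pos assms u by simp
  have D: "D > 0" using r2 by (simp add: D_def add_nonneg_pos)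
  have Fp: "gen_fun y u > 0" by (rule gen_fun_pos) (use u in auto)
  have Cu: "u \<le> C" using u u_crit_le by simp
  obtain M' where M': "r1 * real N < real M'" "real M' < r2 * real N" "gen_fun y u ^ N / D \<le> (P ^ N) $ M' * u ^ M'"
    using elim(1) unfolding r1_def r2_def D_def by blast
  have aM': "(P ^ N) $ M' > 0" by (rule P_power_pos[OF elim(2)])
  have "ln (gen_fun y u ^ N / D) \<le> ln ((P ^ N) $ M' * u ^ M')"
    using M'(3) Fp D by (intro ln_mono) auto
  then have 1: "N * ln (gen_fun y u) - ln D \<le> ln ((P ^ N) $ M') + M' * ln u"
    using Fp D aM' u by (simp add: ln_div ln_mult ln_realpow)
  show ?case
    unfolding r1_def[symmetric] r2_def[symmetric] D_def[symmetric]
  proof (intro allI impI)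
    fix M assume M: "r2 * real N \<le> real M"
    then have MM: "M' \<le> M" using M'(2) by linarith
    have "(P ^ N) $ M' \<le> C ^ (M - M') * (P ^ N) $ M"
      using P_power_steps[OF elim(2), of M' "M - M'"] MM by simp
    then have "ln ((P ^ N) $ M') \<le> ln (C ^ (M - M') * (P ^ N) $ M)"
      using aM' by (intro ln_mono) auto
    also have "\<dots> = (real M - real M') * ln C + ln ((P ^ N) $ M)"
      using C_pos P_power_pos[OF elim(2), of M] MM by (simp add: ln_mult ln_realpow of_nat_diff)
    finally have 2: "ln ((P ^ N) $ M') \<le> (real M - real M') * ln C + ln ((P ^ N) $ M)" .
    have "(real M - real M') * ln (C / u) \<le> (real M - r1 * real N) * ln (C / u)"
      using M'(1) Cu u by (intro mult_right_mono) auto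
    then have 3: "(real M - real M') * (ln C - ln u) \<le> (real M - r1 * real N) * ln (C / u)"
      using u C_pos by (simp add: ln_div)
    show "- (real M - r1 * real N) * ln (C / u) - ln D \<le> log_prob u N M"
      using 1 2 3 unfolding log_prob_def by (simp add: algebra_simps)
  qed
qed

text \<open>Fixing \<open>j\<close> additional headways at the value \<open>K\<close> keeps one
  non-negative term of each convolution; the bracket is the log-probability of one such
  headway.\<close>

lemma log_prob_jumps:
  assumes u: "0 < u" "u < u_crit y" and N: "N \<ge> 1"
  shows "log_prob u N M + j * (ln (y (K + 1)) + K * ln u - ln (gen_fun y u)) \<le> log_prob u (N + j) (M + j * K)"
proof -
  have a: "y (K + 1) ^ j * (P ^ N) $ M \<le> (P ^ (N + j)) $ (M + j * K)"
  proof (induction j)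
    case (Suc j)
    have "y (K + 1) ^ Suc j * (P ^ N) $ M \<le> y (K + 1) * (P ^ (N + j)) $ (M + j * K)"
      using mult_left_mono[OF Suc, of "y (K + 1)"] by (simp add: less_imp_le mult.assoc)
    also have "\<dots> = P $ K * (P ^ (N + j)) $ (M + Suc j * K - K)" by simp
    also have "\<dots> \<le> (\<Sum>i=0..M + Suc j * K. P $ i * (P ^ (N + j)) $ (M + Suc j * K - i))"
      by (rule member_le_sum) (use P_power_nonneg in \<open>auto simp: less_imp_le\<close>)
    also have "\<dots> = (P ^ (N + Suc j)) $ (M + Suc j * K)" by (simp add: fps_mult_nth)
    finally show ?case .
  qed simp
  have "ln (y (K + 1) ^ j * (P ^ N) $ M) \<le> ln ((P ^ (N + j)) $ (M + j * K))"
    using P_power_pos[OF N] by (intro ln_mono a) auto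
  then have "j * ln (y (K + 1)) + ln ((P ^ N) $ M) \<le> ln ((P ^ (N + j)) $ (M + j * K))"
    using P_power_pos[OF N, of M] by (simp add: ln_mult ln_realpow)
  then show ?thesis unfolding log_prob_def by (simp add: algebra_simps)
qed

text \<open>Otherwise \<open>y (K + 1) * x ^ K < 1\<close> for all \<open>K \<ge> K0\<close>, with
  \<open>x = u * exp \<delta>\<close> beyond \<open>u_crit y\<close>; by comparison with a geometric
  series the radius of convergence would exceed \<open>u_crit y\<close>.\<close>

lemma ex_large_gap:
  assumes u: "0 < u" and \<delta>: "u_crit y < u * exp \<delta>"
  shows "\<exists>K\<ge>K0. - (K * \<delta>) \<le> ln (y (K + 1)) + K * ln u"
proof (rule ccontr)
  assume neg: "\<not> ?thesis"
  define x where "x = u * exp \<delta>"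
  have x: "x > 0" using u by (simp add: x_def)
  have lt: "y (K + 1) * x ^ K < 1" if "K \<ge> K0" for K
  proof -
    have "ln (y (K + 1) * x ^ K) = ln (y (K + 1)) + K * ln u + K * \<delta>"
      using u by (simp add: x_def ln_mult ln_realpow algebra_simps)
    also have "\<dots> < 0" using neg that by force
    finally show ?thesis using x by (subst (asm) ln_less_zero_iff) auto
  qed
  obtain z where z: "u_crit y < z" "z < x" using \<delta> dense unfolding x_def by blast
  have z0: "z > 0" using z u_crit_pos by linarith
  have "summable (\<lambda>K. y (K + 1) * z ^ K)"
  proof (rule summable_comparison_test'[where N = K0])
    show "summable (\<lambda>K. (z / x) ^ K)" using z z0 x by (intro summable_geometric) auto
    fix K assume "K \<ge> K0"
    have "y (K + 1) * z ^ K = (y (K + 1) * x ^ K) * (z / x) ^ K"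
      using x by (simp add: power_divide)
    also have "\<dots> \<le> 1 * (z / x) ^ K"
      using lt[OF \<open>K \<ge> K0\<close>] z0 x by (intro mult_right_mono) auto
    finally show "norm (y (K + 1) * z ^ K) \<le> (z / x) ^ K" using z0 by (simp add: abs_mult abs_of_pos)
  qed
  then have "ereal (norm z) \<le> conv_radius (\<lambda>k. y (k + 1))" by (rule conv_radius_geI)
  then show False using z z0 unfolding ereal_u_crit[symmetric] by simp
qed

section \<open>From log-probabilities to the limit of the current\<close>

text \<open>\<open>current_exponential_bound\<close> is used with a small tilt of either sign, which
  squeezes the ratio around \<open>u\<close>. The fugacity \<open>u\<close> may depend on the
  accuracy, so it can approach \<open>u_crit y\<close> without reaching it.\<close>

lemma current_ratio_tendsto:
  fixes N M :: "nat \<Rightarrow> nat"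
  assumes N: "filterlim N at_top sequentially" and M: "\<forall>\<^sub>F L in sequentially. M L \<ge> 1"
    and ex: "\<And>\<delta>. \<delta> > 0 \<Longrightarrow> \<exists>u. 0 < u \<and> u < u_crit y \<and> \<bar>u - u'\<bar> < \<delta> \<and>
      (\<forall>\<^sub>F L in sequentially. - \<delta> * N L \<le> log_prob u (N L) (M L))"
  shows "(\<lambda>L. (P ^ N L) $ (M L - 1) / (P ^ N L) $ M L) \<longlonglongrightarrow> u'"
proof (rule tendstoI)
  fix e :: real assume e: "e > 0"
  \<comment> \<open>\<open>1 / C\<close> makes the tilts \<open>\<eta>\<close> and
    \<open>- \<eta>\<close> admissible; the other bound keeps the total error
    \<open>\<eta> * (C\<^sup>2 + 2)\<close> at most \<open>e\<close>.\<close>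
  define \<eta> where "\<eta> = min (1 / C) (e / (C\<^sup>2 + 2))"
  have C2: "C\<^sup>2 + 2 > 0" by (simp add: add_nonneg_pos)
  have \<eta>: "\<eta> > 0" using e C_pos C2 by (simp add: \<eta>_def)
  have \<eta>C: "\<eta> * C \<le> 1" using C_pos mult_right_mono[of \<eta> "1 / C" C] by (simp add: \<eta>_def)
  have \<eta>e: "\<eta> * (C\<^sup>2 + 2) \<le> e"
    using C2 mult_right_mono[of \<eta> "e / (C\<^sup>2 + 2)" "C\<^sup>2 + 2"] by (simp add: \<eta>_def)
  \<comment> \<open>The bound \<open>\<eta>\<close> controls the distance from \<open>u\<close> to
    \<open>u'\<close>, the bound \<open>\<eta>\<^sup>2\<close> the log-probability, which is later
    divided by \<open>\<eta>\<close>.\<close>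
  define \<delta> where "\<delta> = min \<eta> (\<eta>\<^sup>2)"
  have \<delta>: "\<delta> > 0" "\<delta> \<le> \<eta>" "\<delta> \<le> \<eta> * \<eta>" using \<eta> by (auto simp: \<delta>_def power2_eq_square)
  obtain u where u: "0 < u" "u < u_crit y" "\<bar>u - u'\<bar> < \<delta>"
    and ev: "\<forall>\<^sub>F L in sequentially. - \<delta> * N L \<le> log_prob u (N L) (M L)"
    using ex[OF \<delta>(1)] by blast
  have N1: "\<forall>\<^sub>F L in sequentially. N L \<ge> 1" using N by (simp add: filterlim_at_top)
  show "\<forall>\<^sub>F L in sequentially. dist ((P ^ N L) $ (M L - 1) / (P ^ N L) $ M L) u' < e"
    using ev N1 M
  proof eventually_elim
    case (elim L)
    define R where "R = (P ^ N L) $ (M L - 1) / (P ^ N L) $ M L"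
    define n where "n = real (N L)"
    have n: "n > 0" using elim by (simp add: n_def)
    have 0: "s * R \<le> s * u + s\<^sup>2 * C\<^sup>2 + \<eta> * \<eta>" if "\<bar>s\<bar> = \<eta>" for s
    proof -
      have "n * (s * R) \<le> n * (s * u + s\<^sup>2 * C\<^sup>2) - log_prob u (N L) (M L)"
        unfolding R_def n_def
        by (rule current_exponential_bound) (use u elim \<eta>C that in auto)
      also have "\<dots> \<le> n * (s * u + s\<^sup>2 * C\<^sup>2) + \<delta> * n" using elim(1) by (simp add: n_def)
      also have "\<dots> \<le> n * (s * u + s\<^sup>2 * C\<^sup>2) + (\<eta> * \<eta>) * n"
        using mult_right_mono[OF \<delta>(3), of n] n by simp
      finally have "n * (s * R) \<le> n * (s * u + s\<^sup>2 * C\<^sup>2 + \<eta> * \<eta>)" by (simp add: algebra_simps)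
      then show ?thesis using n by (simp only: mult_le_cancel_left_pos)
    qed
    have "\<eta> * R \<le> \<eta> * u + \<eta>\<^sup>2 * C\<^sup>2 + \<eta> * \<eta>"
      using 0[of \<eta>] \<eta> by simp
    then have "\<eta> * R \<le> \<eta> * (u + \<eta> * C\<^sup>2 + \<eta>)" by (simp add: algebra_simps power2_eq_square)
    then have 1: "R \<le> u + \<eta> * C\<^sup>2 + \<eta>" using \<eta> by simp
    have "(- \<eta>) * R \<le> (- \<eta>) * u + (- \<eta>)\<^sup>2 * C\<^sup>2 + \<eta> * \<eta>"
      using 0[of "- \<eta>"] \<eta> by simp
    then have "\<eta> * (u - \<eta> * C\<^sup>2 - \<eta>) \<le> \<eta> * R" by (simp add: algebra_simps power2_eq_square)
    then have 2: "u - \<eta> * C\<^sup>2 - \<eta> \<le> R" using \<eta> by simp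
    have "\<bar>R - u'\<bar> < \<eta> * C\<^sup>2 + \<eta> + \<eta>" using 1 2 u(3) \<delta>(2) by linarith
    also have "\<dots> \<le> e" using \<eta>e by (simp add: algebra_simps)
    finally show ?case by (simp add: R_def dist_real_def)
  qed
qed

lemma log_linear_tendsto:
  assumes "filterlim N at_top sequentially" "t > 0"
  shows "(\<lambda>L. ln (2 * (t * real (N L) + 1)) / real (N L)) \<longlonglongrightarrow> 0"
proof -
  have "(\<lambda>n::nat. ln (2 * (t * real n + 1)) / real n) \<longlonglongrightarrow> 0"
    using assms(2) by real_asymp
  then show ?thesis using assms(1) by (rule filterlim_compose)
qed

text \<open>\<open>log_prob_lower\<close> is applied with \<open>u2 = u'\<close>, so that the window
  lies below \<open>t * N\<close>, and with \<open>u1\<close> close to \<open>u'\<close>, so that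
  the headway to be added is a small multiple of \<open>N\<close>.\<close>

lemma log_prob_subcritical:
  fixes N M :: "nat \<Rightarrow> nat"
  assumes N: "filterlim N at_top sequentially" and lim: "(\<lambda>L. real (M L) / real (N L)) \<longlonglongrightarrow> t"
    and ge: "\<And>L. t * real (N L) \<le> real (M L)"
    and u': "0 < u'" "u' < u_crit y" "mean_headway y u' = t" and \<delta>: "\<delta> > 0"
  shows "\<exists>u. 0 < u \<and> u < u_crit y \<and> \<bar>u - u'\<bar> < \<delta> \<and>
      (\<forall>\<^sub>F L in sequentially. - \<delta> * N L \<le> log_prob u (N L) (M L))"
proof -
  define \<Lambda> where "\<Lambda> = ln (2 * C / u')"
  have t: "t > 0" using mean_headway_pos[OF u'(1,2)] u'(3) by simp
  have \<Lambda>: "\<Lambda> > 0" using u' u_crit_le by (simp add: \<Lambda>_def)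
  \<comment> \<open>A mean headway \<open>r1 \<ge> t'\<close> ensures
    \<open>(t - r1) * \<Lambda> \<le> \<delta> / 2\<close>; the bound \<open>t / 2\<close> keeps
    \<open>t'\<close> positive.\<close>
  define t' where "t' = max (t - \<delta> / (2 * \<Lambda>)) (t / 2)"
  have t': "0 < t'" "t' < t" using t \<delta> \<Lambda> by (auto simp: t'_def)
  obtain v where v: "0 < v" "v < u'" "mean_headway y v = t'"
    using mean_headway_IVT[OF t'(1) u'(1,2)] t'(2) u'(3) by auto
  \<comment> \<open>\<open>v\<close> gives mean headway at least \<open>t'\<close>,
    \<open>u' / 2\<close> makes \<open>\<Lambda>\<close> a bound for \<open>ln (C / u)\<close>, and
    \<open>u' - \<delta> / 2\<close> controls the distance from \<open>u\<close> to
    \<open>u'\<close>.\<close>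
  define u1 where "u1 = max v (max (u' / 2) (u' - \<delta> / 2))"
  define u where "u = (u1 + u') / 2"
  define r1 where "r1 = mean_headway y u1"
  have u1: "0 < u1" "u1 < u'" "v \<le> u1" "u' / 2 \<le> u1" "u' - \<delta> / 2 \<le> u1"
    using v u' \<delta> unfolding u1_def by linarith+
  have u: "u1 < u" "u < u'" "0 < u" "u < u_crit y" using u1 u' by (auto simp: u_def)
  have "t' \<le> r1" unfolding r1_def v(3)[symmetric] by (rule mean_headway_mono) (use v u1 u' in auto)
  then have "t - r1 \<le> \<delta> / (2 * \<Lambda>)" unfolding t'_def by linarith
  then have "(t - r1) * \<Lambda> \<le> \<delta> / (2 * \<Lambda>) * \<Lambda>" using \<Lambda> by (intro mult_right_mono) auto
  then have small: "(t - r1) * \<Lambda> + 0 < \<delta>" using \<Lambda> \<delta> by simp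
  have r1t: "r1 < t" unfolding r1_def u'(3)[symmetric] by (rule mean_headway_strict_mono) (use u1 u' in auto)
  have L\<Lambda>: "ln (C / u) \<le> \<Lambda>"
    unfolding \<Lambda>_def
  proof (rule ln_mono)
    have "C * u' \<le> C * (2 * u)" using u1 u C_pos by (intro mult_left_mono) auto
    then show "C / u \<le> 2 * C / u'" using u(3) u'(1) by (simp add: field_simps)
  qed (use C_pos u in auto)
  have "(\<lambda>L. (real (M L) / real (N L) - r1) * \<Lambda> + ln (2 * (t * real (N L) + 1)) / real (N L))
      \<longlonglongrightarrow> (t - r1) * \<Lambda> + 0"
    by (intro tendsto_intros lim log_linear_tendsto[OF N t])
  then have "\<forall>\<^sub>F L in sequentially.
      (real (M L) / real (N L) - r1) * \<Lambda> + ln (2 * (t * real (N L) + 1)) / real (N L) < \<delta>"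
    by (rule order_tendstoD(2)) (rule small)
  moreover have "\<forall>\<^sub>F L in sequentially. \<forall>m. t * real (N L) \<le> real m \<longrightarrow>
      - (real m - r1 * real (N L)) * ln (C / u) - ln (2 * (t * real (N L) + 1)) \<le> log_prob u (N L) m"
    using eventually_compose_filterlim[OF log_prob_lower[OF u1(1) u(1) u(2) u'(2)] N]
    unfolding u'(3) r1_def .
  moreover have "\<forall>\<^sub>F L in sequentially. N L \<ge> 1" using N by (simp add: filterlim_at_top)
  ultimately have "\<forall>\<^sub>F L in sequentially. - \<delta> * N L \<le> log_prob u (N L) (M L)"
  proof eventually_elim
    case (elim L)
    define n m where "n = real (N L)" and "m = real (M L)"
    have n: "n > 0" using elim by (simp add: n_def)
    have "r1 * n \<le> t * n" using r1t n by (intro mult_right_mono) auto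
    then have rm: "r1 * n \<le> m" using ge[of L] by (simp add: n_def m_def)
    have "(m / n - r1) * \<Lambda> + ln (2 * (t * n + 1)) / n < \<delta>" using elim(1) by (simp add: n_def m_def)
    from mult_strict_right_mono[OF this n]
    have "((m / n - r1) * \<Lambda> + ln (2 * (t * n + 1)) / n) * n < \<delta> * n" .
    also have "((m / n - r1) * \<Lambda> + ln (2 * (t * n + 1)) / n) * n
        = (m - r1 * n) * \<Lambda> + ln (2 * (t * n + 1))"
      using n by (simp add: field_simps)
    finally have "(m - r1 * n) * \<Lambda> + ln (2 * (t * n + 1)) < \<delta> * n" .
    moreover have "(m - r1 * n) * ln (C / u) \<le> (m - r1 * n) * \<Lambda>"
      using L\<Lambda> rm by (intro mult_left_mono) auto
    moreover have "- (m - r1 * n) * ln (C / u) - ln (2 * (t * n + 1)) \<le> log_prob u (N L) (M L)"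
      using elim(2) ge[of L] by (simp add: n_def m_def)
    ultimately have "- (\<delta> * n) \<le> log_prob u (N L) (M L)" by linarith
    then show ?case by (simp add: n_def)
  qed
  moreover have "\<bar>u - u'\<bar> < \<delta>" using u u1 \<delta> by auto
  ultimately show ?thesis using u by blast
qed

text \<open>\<open>N - j\<close> headways are kept near a window just below \<open>rc\<close>; the
  excess is carried by \<open>j\<close> headways of a fixed large length \<open>K\<close>. With
  log-probability at least \<open>- (2 * \<delta> * K)\<close> each, these cost at most
  \<open>2 * \<delta> * M\<close> altogether.\<close>

lemma log_prob_supercritical:
  fixes N M :: "nat \<Rightarrow> nat"
  assumes N: "filterlim N at_top sequentially" and lim: "(\<lambda>L. real (M L) / real (N L)) \<longlonglongrightarrow> t"
    and ge: "\<And>L. t * real (N L) \<le> real (M L)"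
    and below: "\<And>u. 0 < u \<Longrightarrow> u < u_crit y \<Longrightarrow> mean_headway y u < rc"
    and approx: "\<And>e. e > 0 \<Longrightarrow> \<exists>u. 0 < u \<and> u < u_crit y \<and> rc - e < mean_headway y u"
    and rct: "rc \<le> t" and \<epsilon>: "\<epsilon> > 0"
  shows "\<exists>u. 0 < u \<and> u < u_crit y \<and> \<bar>u - u_crit y\<bar> < \<epsilon> \<and>
      (\<forall>\<^sub>F L in sequentially. - \<epsilon> * N L \<le> log_prob u (N L) (M L))"
proof -
  define uc where "uc = u_crit y"
  define \<Lambda> where "\<Lambda> = ln (2 * C / uc)"
  have uc: "uc > 0" unfolding uc_def by (rule u_crit_pos)
  have rc: "rc > 0" using below[of "uc / 2"] mean_headway_pos[of "uc / 2"] uc by (simp add: uc_def)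
  have t: "t > 0" using rc rct by simp
  have \<Lambda>: "\<Lambda> > 0" using uc u_crit_le by (simp add: \<Lambda>_def uc_def)
  \<comment> \<open>Error budget per particle: \<open>\<delta>\<close> for the width of the window,
    \<open>\<delta>\<close> for the \<open>j\<close> particles missing from it,
    \<open>2 * \<delta> * t\<close> for the long headways.\<close>
  define \<delta> where "\<delta> = \<epsilon> / (2 + 2 * t)"
  have \<delta>: "\<delta> > 0" using \<epsilon> t by (simp add: \<delta>_def)
  have \<delta>\<epsilon>: "(2 + 2 * t) * \<delta> = \<epsilon>" using t by (simp add: \<delta>_def)
  have "\<delta> * 1 \<le> \<delta> * (2 + 2 * t)" using \<delta> t by (intro mult_left_mono) auto
  then have \<delta>le: "\<delta> \<le> \<epsilon>" using \<delta>\<epsilon> by (simp add: mult.commute)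
  obtain v where v: "0 < v" "v < uc" "rc - \<delta> / \<Lambda> < mean_headway y v"
    using approx[of "\<delta> / \<Lambda>"] \<delta> \<Lambda> by (auto simp: uc_def)
  \<comment> \<open>\<open>v\<close> brings the mean headway within
    \<open>\<delta> / \<Lambda>\<close> of \<open>rc\<close>, \<open>uc / 2\<close> makes
    \<open>\<Lambda>\<close> a bound for \<open>ln (C / u)\<close>, \<open>uc - \<delta> / 2\<close>
    controls the distance to \<open>uc\<close>, and \<open>uc * exp (- \<delta>)\<close> is for
    \<open>ex_large_gap\<close>.\<close>
  define u1 where "u1 = max (max v (uc / 2)) (max (uc - \<delta> / 2) (uc * exp (- \<delta>)))"
  define u u2 where "u = (u1 + uc) / 2" and "u2 = (u + uc) / 2"
  define r1 r2 where "r1 = mean_headway y u1" and "r2 = mean_headway y u2"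
  have "uc * exp (- \<delta>) < uc" using uc \<delta> by simp
  then have u1: "0 < u1" "u1 < uc" "v \<le> u1" "uc / 2 \<le> u1" "uc - \<delta> / 2 \<le> u1" "uc * exp (- \<delta>) \<le> u1"
    using v uc \<delta> unfolding u1_def by linarith+
  have u: "u1 < u" "u < uc" "0 < u" and u2: "u < u2" "u2 < uc" using u1 by (auto simp: u_def u2_def)
  have u_uc: "u < u_crit y" using u by (simp add: uc_def)
  have "uc = uc * exp (- \<delta>) * exp \<delta>" by (simp add: exp_minus)
  also have "\<dots> < u * exp \<delta>" using u1 u by (intro mult_strict_right_mono) auto
  finally have ue: "u_crit y < u * exp \<delta>" by (simp add: uc_def)
  have r1: "rc - \<delta> / \<Lambda> < r1" "0 < r1" "r1 < rc"
    using mean_headway_mono[of v u1] mean_headway_pos[of u1] below[of u1] v u1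
    by (auto simp: r1_def uc_def)
  have r2: "0 < r2" "r2 < rc" "r1 < r2"
    using mean_headway_strict_mono[of u1 u2] mean_headway_pos[of u2] below[of u2] u1 u u2
    by (auto simp: r1_def r2_def uc_def)
  have "(r2 - r1) * \<Lambda> < (\<delta> / \<Lambda>) * \<Lambda>" using \<Lambda> r1 r2 by (intro mult_strict_right_mono) auto
  then have r21: "(r2 - r1) * \<Lambda> < \<delta>" using \<Lambda> by simp
  \<comment> \<open>In this order: \<open>K\<close> is positive, the normalisation
    \<open>ln (gen_fun y u)\<close> costs at most \<open>\<delta> * K\<close>, the particles missing
    from the window cost at most \<open>\<delta>\<close> per particle in the limit, and eventually
    \<open>2 * j L \<le> N L\<close>.\<close>
  define K0 where "K0 = max 1 (max (nat \<lceil>ln (gen_fun y u) / \<delta>\<rceil>) (max (nat \<lceil>rc * t * \<Lambda> / \<delta>\<rceil>) (nat \<lceil>2 * (t + 1)\<rceil>)))"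
  obtain K where K: "K \<ge> K0" "- (real K * \<delta>) \<le> ln (y (K + 1)) + K * ln u"
    using ex_large_gap[OF u(3) ue] by blast
  have K1: "real K \<ge> 1" "ln (gen_fun y u) / \<delta> \<le> real K" "rc * t * \<Lambda> / \<delta> \<le> real K" "2 * (t + 1) \<le> real K"
    using K(1) unfolding K0_def by linarith+
  define b where "b = ln (y (K + 1)) + K * ln u - ln (gen_fun y u)"
  have b: "- (2 * \<delta> * K) \<le> b"
    using K(2) K1(2) \<delta> unfolding b_def by (simp add: field_simps)
  have small_K: "rc * t / K * \<Lambda> \<le> \<delta>" using K1 \<delta> by (simp add: field_simps)
  have L\<Lambda>: "ln (C / u) \<le> \<Lambda>"
    unfolding \<Lambda>_def
  proof (rule ln_mono)
    have "C * uc \<le> C * (2 * u)" using u1 u C_pos by (intro mult_left_mono) auto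
    then show "C / u \<le> 2 * C / uc" using u(3) uc by (simp add: field_simps)
  qed (use C_pos u in auto)
  have L0: "0 \<le> ln (C / u)" using u u_uc u_crit_le by simp
  \<comment> \<open>Rounding down leaves the other \<open>N - j\<close> headways a total of at least
    \<open>r2 * N\<close> and less than \<open>r2 * N + K\<close>.\<close>
  define j where "j = (\<lambda>L. nat \<lfloor>(real (M L) - r2 * real (N L)) / K\<rfloor>)"
  have r2M: "r2 * real (N L) \<le> real (M L)" for L
    using mult_right_mono[of r2 t "real (N L)"] r2 rct ge[of L] by simp
  have j: "real (j L) * K \<le> real (M L) - r2 * real (N L)"
    "real (M L) - r2 * real (N L) < real (j L) * K + K" for L
  proof -
    define q where "q = (real (M L) - r2 * real (N L)) / K"
    have q: "q \<ge> 0" using r2M[of L] by (simp add: q_def)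
    have "real (j L) = of_int \<lfloor>q\<rfloor>" using q unfolding j_def q_def[symmetric] by simp
    then have "real (j L) \<le> q" "q < real (j L) + 1" by linarith+
    then show "real (j L) * K \<le> real (M L) - r2 * real (N L)"
      "real (M L) - r2 * real (N L) < real (j L) * K + K"
      using K1(1) unfolding q_def by (simp_all add: field_simps)
  qed
  have "\<forall>\<^sub>F L in sequentially. real (M L) / real (N L) < t + 1"
    using lim by (rule order_tendstoD(2)) simp
  moreover have N1: "\<forall>\<^sub>F L in sequentially. N L \<ge> 1" using N by (simp add: filterlim_at_top)
  ultimately have jN: "\<forall>\<^sub>F L in sequentially. 2 * j L \<le> N L"
  proof eventually_elim
    case (elim L)
    have "real (M L) < (t + 1) * real (N L)" using elim by (simp add: field_simps)
    moreover have "0 \<le> r2 * real (N L)" using r2 by simp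
    ultimately have "2 * (real (j L) * K) \<le> 2 * (t + 1) * real (N L)" using j(1)[of L] by linarith
    also have "\<dots> \<le> K * real (N L)" using K1(4) by (intro mult_right_mono) auto
    finally have "K * real (2 * j L) \<le> K * real (N L)" by (simp add: mult_ac)
    then show ?case using K1(1) by (simp add: mult_le_cancel_left)
  qed
  have N': "filterlim (\<lambda>L. N L - j L) at_top sequentially"
    unfolding filterlim_at_top
  proof
    fix Z
    have "\<forall>\<^sub>F L in sequentially. 2 * Z \<le> N L" using N by (simp add: filterlim_at_top)
    with jN show "\<forall>\<^sub>F L in sequentially. Z \<le> N L - j L" by eventually_elim linarith
  qed
  have "((r2 - r1) + K * 0 + rc * t / K) * \<Lambda> + 0 + 2 * \<delta> * t < (2 + 2 * t) * \<delta>"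
    using r21 small_K by (simp add: algebra_simps)
  then have lim_lt: "((r2 - r1) + K * 0 + rc * t / K) * \<Lambda> + 0 + 2 * \<delta> * t < \<epsilon>" unfolding \<delta>\<epsilon> .
  have "(\<lambda>L. inverse (real (N L))) \<longlonglongrightarrow> 0"
    by (rule filterlim_compose[OF lim_inverse_n N])
  then have "(\<lambda>L. ((r2 - r1) + K * inverse (real (N L)) + rc * (real (M L) / real (N L)) / K) * \<Lambda>
      + ln (2 * (r2 * real (N L) + 1)) / real (N L) + 2 * \<delta> * (real (M L) / real (N L)))
      \<longlonglongrightarrow> ((r2 - r1) + K * 0 + rc * t / K) * \<Lambda> + 0 + 2 * \<delta> * t"
    using K1(1) by (intro tendsto_intros lim log_linear_tendsto[OF N r2(1)]) auto
  then have "\<forall>\<^sub>F L in sequentially. ((r2 - r1) + K * inverse (real (N L)) + rc * (real (M L) / real (N L)) / K) * \<Lambda>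
      + ln (2 * (r2 * real (N L) + 1)) / real (N L) + 2 * \<delta> * (real (M L) / real (N L)) < \<epsilon>"
    by (rule order_tendstoD(2)) (rule lim_lt)
  moreover have "\<forall>\<^sub>F L in sequentially. \<forall>m. r2 * real (N L - j L) \<le> real m \<longrightarrow>
      - (real m - r1 * real (N L - j L)) * ln (C / u) - ln (2 * (r2 * real (N L - j L) + 1))
        \<le> log_prob u (N L - j L) m"
    using eventually_compose_filterlim[OF log_prob_lower[OF u1(1) u(1) u2[unfolded uc_def]] N']
    unfolding r1_def r2_def .
  moreover have "\<forall>\<^sub>F L in sequentially. N L - j L \<ge> 1" using N' by (simp only: filterlim_at_top)
  ultimately have "\<forall>\<^sub>F L in sequentially. - \<epsilon> * N L \<le> log_prob u (N L) (M L)"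
    using N1 jN
  proof eventually_elim
    case (elim L)
    define n m i where "n = real (N L)" and "m = real (M L)" and "i = real (j L)"
    have n: "n > 0" using elim by (simp add: n_def)
    have ji: "i * K \<le> m - r2 * n" "m - r2 * n < i * K + K"
      using j[of L] by (simp_all add: n_def m_def i_def)
    have r2n: "0 \<le> r2 * n" "0 \<le> r2 * i" using r2 n by (simp_all add: i_def)
    have "real (j L * K) \<le> real (M L)" using ji(1) r2n by (simp add: i_def m_def)
    then have jKM: "j L * K \<le> M L" by linarith
    have jN': "j L \<le> N L" using elim by simp
    define n1 m1 where "n1 = real (N L - j L)" and "m1 = real (M L - j L * K)"
    have n1: "n1 = n - i" and m1: "m1 = m - i * K"
      using jKM jN' by (simp_all add: n1_def m1_def n_def m_def i_def of_nat_diff)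
    have n10: "n1 > 0" using elim by (simp add: n1_def)
    have "r2 * n1 \<le> r2 * n" using r2 by (simp add: n1 i_def)
    then have "r2 * n1 \<le> m1" using ji r2n by (simp add: m1)
    then have A: "- (m1 - r1 * n1) * ln (C / u) - ln (2 * (r2 * n1 + 1)) \<le> log_prob u (N L - j L) (M L - j L * K)"
      using elim(2) unfolding n1_def m1_def by blast
    have B: "log_prob u (N L - j L) (M L - j L * K) + i * b \<le> log_prob u (N L) (M L)"
      using log_prob_jumps[OF u(3) u_uc elim(3), of "M L - j L * K" "j L" K] jKM jN'
      unfolding b_def i_def by simp
    have "i * K \<le> m" using ji(1) r2n by linarith
    then have iK: "i \<le> m / K" using K1(1) by (simp add: field_simps)
    have "- (2 * \<delta> * m) \<le> - (2 * \<delta> * (i * K))" using \<open>i * K \<le> m\<close> \<delta> by simp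
    also have "\<dots> = i * (- (2 * \<delta> * K))" by simp
    also have "\<dots> \<le> i * b" using b by (intro mult_left_mono) (simp_all add: i_def)
    finally have D: "- (2 * \<delta> * m) \<le> i * b" .
    have "r1 * i \<le> rc * (m / K)" using iK r1 rc by (intro mult_mono) (auto simp: i_def)
    \<comment> \<open>The three terms are the width of the window, the rounding in \<open>j\<close>
      and the share of the \<open>j\<close> missing particles.\<close>
    then have "m1 - r1 * n1 \<le> (r2 - r1) * n + K + rc * (m / K)"
      using ji by (simp add: m1 n1 algebra_simps)
    moreover have "0 \<le> m1 - r1 * n1"
    proof -
      have "r1 * n1 \<le> r2 * n1" using r2 n10 by (intro mult_right_mono) auto
      then show ?thesis using \<open>r2 * n1 \<le> m1\<close> by simp
    qed
    ultimately have E: "(m1 - r1 * n1) * ln (C / u) \<le> ((r2 - r1) * n + K + rc * (m / K)) * \<Lambda>"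
      using L\<Lambda> L0 by (intro mult_mono) auto
    have F: "ln (2 * (r2 * n1 + 1)) \<le> ln (2 * (r2 * n + 1))"
      using \<open>r2 * n1 \<le> r2 * n\<close> r2 n10 by (intro ln_mono) (simp_all add: add_pos_pos)
    have "((r2 - r1) + K * inverse n + rc * (m / n) / K) * \<Lambda>
      + ln (2 * (r2 * n + 1)) / n + 2 * \<delta> * (m / n) < \<epsilon>"
      using elim(1) by (simp add: n_def m_def)
    from mult_strict_right_mono[OF this n]
    have "(((r2 - r1) + K * inverse n + rc * (m / n) / K) * \<Lambda>
      + ln (2 * (r2 * n + 1)) / n + 2 * \<delta> * (m / n)) * n < \<epsilon> * n" .
    also have "(((r2 - r1) + K * inverse n + rc * (m / n) / K) * \<Lambda>
      + ln (2 * (r2 * n + 1)) / n + 2 * \<delta> * (m / n)) * n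
      = ((r2 - r1) * n + K + rc * (m / K)) * \<Lambda> + ln (2 * (r2 * n + 1)) + 2 * \<delta> * m"
      using n K1(1) by (simp add: field_simps)
    finally have "((r2 - r1) * n + K + rc * (m / K)) * \<Lambda> + ln (2 * (r2 * n + 1)) + 2 * \<delta> * m < \<epsilon> * n" .
    then have "- (\<epsilon> * n) \<le> log_prob u (N L) (M L)" using A B D E F by linarith
    then show ?case by (simp add: n_def)
  qed
  moreover have "\<bar>u - u_crit y\<bar> < \<epsilon>" using u u1 \<delta> \<delta>le by (auto simp: uc_def)
  ultimately show ?thesis using u u_uc by blast
qed

subsection \<open>The critical density and the limit of the current\<close>

text \<open>By monotonicity the left limit exists and equals the supremum, so the \<open>Lim\<close>
  in the definition is a genuine limit.\<close>

lemma mean_headway_crit_eq: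
  "mean_headway_crit y = (SUP u\<in>{0<..<u_crit y}. ereal (mean_headway y u))"
proof -
  let ?S = "SUP u\<in>{0<..<u_crit y}. ereal (mean_headway y u)"
  have uc: "\<forall>\<^sub>F u in at_left (u_crit y). u < u_crit y"
    by (simp add: eventually_at_filter)
  have "((\<lambda>u. ereal (mean_headway y u)) \<longlongrightarrow> ?S) (at_left (u_crit y))"
  proof (rule order_tendstoI)
    fix a assume "a < ?S"
    then obtain v where v: "0 < v" "v < u_crit y" "a < ereal (mean_headway y v)"
      by (auto simp: less_SUP_iff)
    have "\<forall>\<^sub>F u in at_left (u_crit y). v < u"
      using v(2) by (rule eventually_at_leftI[where a = v, rotated]) auto
    with uc show "\<forall>\<^sub>F u in at_left (u_crit y). a < ereal (mean_headway y u)"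
    proof eventually_elim
      case (elim u)
      then show ?case using v mean_headway_mono[of v u] by (meson ereal_less_eq(3) less_imp_le less_le_trans)
    qed
  next
    fix a assume a: "?S < a"
    have "\<forall>\<^sub>F u in at_left (u_crit y). 0 < u"
      using u_crit_pos by (rule eventually_at_leftI[where a = 0, rotated]) auto
    with uc show "\<forall>\<^sub>F u in at_left (u_crit y). ereal (mean_headway y u) < a"
    proof eventually_elim
      case (elim u)
      then have "ereal (mean_headway y u) \<le> ?S" by (intro SUP_upper) simp
      then show ?case using a by simp
    qed
  qed
  then show ?thesis unfolding mean_headway_crit_def by (intro tendsto_Lim) simp_all
qed

lemma fugacity_eq:
  assumes "0 < u" "u < u_crit y"
  shows "fugacity y (mean_headway y u) = u"
proof -
  define v where "v = (u + u_crit y) / 2"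
  have v: "u < v" "v < u_crit y" using assms by (auto simp: v_def)
  \<comment> \<open>The value lies strictly below the critical one, so the first branch of
    \<open>fugacity\<close> does not apply.\<close>
  have "ereal (mean_headway y u) < ereal (mean_headway y v)"
    using mean_headway_strict_mono[OF assms(1) v] by simp
  also have "\<dots> \<le> mean_headway_crit y"
    unfolding mean_headway_crit_eq by (rule SUP_upper) (use assms v in auto)
  finally have ne: "ereal (mean_headway y u) \<noteq> mean_headway_crit y" by simp
  have "inj_on (mean_headway y) {0<..<u_crit y}"
    by (rule linorder_inj_onI') (use mean_headway_strict_mono in fastforce)
  then have "the_inv_into {0<..<u_crit y} (mean_headway y) (mean_headway y u) = u"
    using assms by (intro the_inv_into_f_f) auto
  then show ?thesis using ne by (simp add: fugacity_def)
qed

text \<open>Below the critical headway some fugacity has mean headway \<open>t\<close>. From there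
  on none does, and the ratio saturates at \<open>u_crit y\<close>.\<close>

lemma current_ratio_limit:
  fixes N M :: "nat \<Rightarrow> nat"
  assumes N: "filterlim N at_top sequentially" and M: "\<forall>\<^sub>F L in sequentially. M L \<ge> 1"
    and lim: "(\<lambda>L. real (M L) / real (N L)) \<longlonglongrightarrow> t"
    and ge: "\<And>L. t * real (N L) \<le> real (M L)" and t: "t > 0"
  shows "(\<lambda>L. (P ^ N L) $ (M L - 1) / (P ^ N L) $ M L)
    \<longlonglongrightarrow> (if ereal t < mean_headway_crit y then fugacity y t else u_crit y)"
proof (cases "ereal t < mean_headway_crit y")
  case True
  then obtain v where v: "0 < v" "v < u_crit y" "t < mean_headway y v"
    by (auto simp: mean_headway_crit_eq less_SUP_iff)
  obtain u where u: "0 < u" "u < v" "mean_headway y u = t"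
    using mean_headway_IVT[OF t v] by blast
  have uc: "u < u_crit y" using u v by simp
  have "(\<lambda>L. (P ^ N L) $ (M L - 1) / (P ^ N L) $ M L) \<longlonglongrightarrow> u"
    using N M by (rule current_ratio_tendsto) (rule log_prob_subcritical[OF N lim ge u(1) uc u(3)])
  then show ?thesis using fugacity_eq[OF u(1) uc] True u(3) by simp
next
  case False
  define rc where "rc = real_of_ereal (mean_headway_crit y)"
  have up: "ereal (mean_headway y u) \<le> mean_headway_crit y" if "0 < u" "u < u_crit y" for u
    unfolding mean_headway_crit_eq by (rule SUP_upper) (use that in auto)
  have "mean_headway_crit y \<noteq> - \<infinity>" using up[of "u_crit y / 2"] u_crit_pos by auto
  then have rc: "mean_headway_crit y = ereal rc" "rc \<le> t"
    using False unfolding rc_def by (cases "mean_headway_crit y"; simp)+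
  \<comment> \<open>By strict monotonicity the supremum is not attained.\<close>
  have below: "mean_headway y u < rc" if "0 < u" "u < u_crit y" for u
  proof -
    have "mean_headway y u < mean_headway y ((u + u_crit y) / 2)"
      by (rule mean_headway_strict_mono) (use that in auto)
    also have "\<dots> \<le> rc" using up[of "(u + u_crit y) / 2"] that rc by simp
    finally show ?thesis .
  qed
  have approx: "\<exists>u. 0 < u \<and> u < u_crit y \<and> rc - e < mean_headway y u" if "e > 0" for e
  proof -
    have "ereal (rc - e) < mean_headway_crit y" using rc that by simp
    then show ?thesis by (auto simp: mean_headway_crit_eq less_SUP_iff)
  qed
  have "(\<lambda>L. (P ^ N L) $ (M L - 1) / (P ^ N L) $ M L) \<longlonglongrightarrow> u_crit y"
    using N M by (rule current_ratio_tendsto) (rule log_prob_supercritical[OF N lim ge below approx rc(2)])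
  then show ?thesis using False by simp
qed

text \<open>The map from mean headway \<open>r\<close> to density \<open>1 / (1 + r)\<close>
  reverses the order. The two sides put the critical point into different branches, but
  \<open>fugacity\<close> equals \<open>u_crit y\<close> there. An infinite critical headway means
  \<open>rho_crit y = 0\<close>, and only the first branches occur.\<close>

lemma current_density_fugacity:
  assumes \<rho>: "0 < \<rho>" "\<rho> < 1"
  shows "(if ereal (1 / \<rho> - 1) < mean_headway_crit y then fugacity y (1 / \<rho> - 1) else u_crit y)
    = (if rho_crit y \<le> \<rho> then fugacity y (1 / \<rho> - 1) else fugacity y (1 / rho_crit y - 1))"
proof (cases "mean_headway_crit y")
  case (real rc)
  have "ereal (mean_headway y (u_crit y / 2)) \<le> mean_headway_crit y"
    unfolding mean_headway_crit_eq by (rule SUP_upper) (use u_crit_pos in auto)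
  then have rc: "rc > 0"
    using mean_headway_pos[of "u_crit y / 2"] u_crit_pos real by simp
  have rho: "rho_crit y = 1 / (1 + rc)" using real by (simp add: rho_crit_def)
  have le: "rho_crit y \<le> \<rho> \<longleftrightarrow> 1 / \<rho> - 1 \<le> rc"
    using rc \<rho> unfolding rho by (simp add: field_simps)
  have "fugacity y rc = u_crit y" using real by (simp add: fugacity_def)
  then show ?thesis using le rc unfolding real rho by (cases "1 / \<rho> - 1 = rc") auto
next
  case PInf
  then show ?thesis using \<rho> by (simp add: rho_crit_def)
next
  case MInf
  have "ereal (mean_headway y (u_crit y / 2)) \<le> mean_headway_crit y"
    unfolding mean_headway_crit_eq by (rule SUP_upper) (use u_crit_pos in auto)
  then show ?thesis using MInf by simp
qed
end

section \<open>Passage to the limit at fixed density\<close>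

text \<open>Rounding the particle number down gives the one-sided bound on the number of empty sites
  for every \<open>L\<close>, which is what allows windows to be placed below the target.\<close>

lemma floor_density_asymptotics:
  fixes \<rho> :: real
  assumes \<rho>: "0 < \<rho>" "\<rho> < 1" and N_def: "N = (\<lambda>L. nat \<lfloor>\<rho> * real L\<rfloor>)"
  shows "filterlim N at_top sequentially"
    and "(\<lambda>L. real (N L) / real L) \<longlonglongrightarrow> \<rho>"
    and "(\<lambda>L. real (L - N L) / real (N L)) \<longlonglongrightarrow> 1 / \<rho> - 1"
    and "(1 / \<rho> - 1) * real (N L) \<le> real (L - N L)"
    and "L \<ge> 1 \<Longrightarrow> N L < L"
proof -
  have le: "real (N L) \<le> \<rho> * real L" and ge: "\<rho> * real L - 1 \<le> real (N L)" for L
  proof -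
    have "real (N L) = of_int \<lfloor>\<rho> * real L\<rfloor>" using \<rho> by (simp add: N_def)
    then show "real (N L) \<le> \<rho> * real L" "\<rho> * real L - 1 \<le> real (N L)" by linarith+
  qed
  have lt: "N L < L" if "L \<ge> 1" for L
  proof -
    have "\<rho> * real L < 1 * real L" using \<rho> that by (intro mult_strict_right_mono) auto
    then show ?thesis using le[of L] by simp
  qed
  then show "L \<ge> 1 \<Longrightarrow> N L < L" .
  have leL: "N L \<le> L" for L using lt[of L] le[of L] by (cases "L = 0") auto
  show "(1 / \<rho> - 1) * real (N L) \<le> real (L - N L)"
    using le[of L] leL[of L] \<rho> by (simp add: of_nat_diff field_simps)
  show N: "filterlim N at_top sequentially"
    unfolding filterlim_at_top
  proof
    fix Z
    have "\<forall>\<^sub>F L in sequentially. (real Z + 1) / \<rho> \<le> real L"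
      using filterlim_real_sequentially by (simp add: filterlim_at_top)
    then show "\<forall>\<^sub>F L in sequentially. Z \<le> N L"
    proof eventually_elim
      case (elim L)
      then have "real Z + 1 \<le> \<rho> * real L" using \<rho> by (simp add: field_simps)
      then show ?case using ge[of L] by linarith
    qed
  qed
  show lim: "(\<lambda>L. real (N L) / real L) \<longlonglongrightarrow> \<rho>"
  proof (rule tendsto_sandwich)
    show "(\<lambda>L. \<rho> - 1 / real L) \<longlonglongrightarrow> \<rho>"
      using tendsto_diff[OF tendsto_const lim_1_over_n, of \<rho>] by simp
    show "\<forall>\<^sub>F L in sequentially. \<rho> - 1 / real L \<le> real (N L) / real L"
      using eventually_gt_at_top[of 0]
    proof eventually_elim
      case (elim L)
      have "\<rho> - 1 / real L = (\<rho> * real L - 1) / real L" using elim by (simp add: field_simps)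
      also have "\<dots> \<le> real (N L) / real L" by (rule divide_right_mono[OF ge]) simp
      finally show ?case .
    qed
    show "\<forall>\<^sub>F L in sequentially. real (N L) / real L \<le> \<rho>"
      using eventually_gt_at_top[of 0]
    proof eventually_elim
      case (elim L)
      then show ?case using le[of L] by (simp add: field_simps)
    qed
  qed (rule tendsto_const)
  have "(\<lambda>L. 1 / (real (N L) / real L) - 1) \<longlonglongrightarrow> 1 / \<rho> - 1"
    by (intro tendsto_intros lim) (use \<rho> in simp)
  moreover have "\<forall>\<^sub>F L in sequentially. N L \<ge> 1" using N by (simp add: filterlim_at_top)
  then have "\<forall>\<^sub>F L in sequentially. 1 / (real (N L) / real L) - 1 = real (L - N L) / real (N L)"
  proof eventually_elim
    case (elim L)
    then show ?case using leL[of L] by (simp add: of_nat_diff field_simps)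
  qed
  ultimately show "(\<lambda>L. real (L - N L) / real (N L)) \<longlonglongrightarrow> 1 / \<rho> - 1"
    by (rule Lim_transform_eventually)
qed

text \<open>Finite values of \<open>J\<close> let \<open>real_of_ereal\<close> split the difference;
  at \<open>n = 0\<close> both sides vanish because \<open>pot_weight J 0 = 0\<close>.\<close>

lemma tahep_rate_eq:
  assumes J: "\<And>k. k \<ge> 1 \<Longrightarrow> \<bar>J k\<bar> \<noteq> \<infinity>"
  shows "tahep_rate w J n = w * pot_weight J n / pot_weight J (n + 1)"
proof (cases "n = 0")
  case False
  then have "real_of_ereal (J (n + 1) - J n) = real_of_ereal (J (n + 1)) - real_of_ereal (J n)"
    using J[of n] J[of "n + 1"] by (cases "J n"; cases "J (n + 1)") auto
  then show ?thesis using False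
    by (simp add: tahep_rate_def pot_weight_def exp_diff exp_minus divide_simps)
qed (simp add: tahep_rate_def pot_weight_def)

theorem theorem3p12:
  fixes J :: "nat \<Rightarrow> ereal" and y :: "nat \<Rightarrow> real" and w \<rho> :: real
  assumes "J 0 = \<infinity>"
    and "\<And>k. k \<ge> 1 \<Longrightarrow> \<bar>J k\<bar> \<noteq> \<infinity>"
    and "y = pot_weight J"
    and "bounded (range (\<lambda>n. y n / y (n + 1)))"
    and "conv_radius (\<lambda>k. y (k + 1)) > 0"
    and "w > 0"
    and "\<rho> \<in> {0<..<1}"
  shows "(\<lambda>L. stationary_current (tahep_rate w J) y L (nat \<lfloor>\<rho> * real L\<rfloor>))
    \<longlonglongrightarrow> (if \<rho> \<ge> rho_crit y
        then w * \<rho> * fugacity y (1 / \<rho> - 1)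
        else w * \<rho> * fugacity y (1 / rho_crit y - 1))"
proof -
  have y_0: "y 0 = 0" and y_pos: "\<And>k. k \<ge> 1 \<Longrightarrow> y k > 0"
    by (simp_all add: assms(3) pot_weight_def)
  obtain C where C: "\<And>n. norm (y n / y (n + 1)) \<le> C"
    using assms(4) unfolding bounded_iff by auto
  interpret headway_series y C
  proof
    fix n
    show "y n \<le> C * y (n + 1)"
      using C[of n] y_pos[of "n + 1"] by (simp add: abs_le_iff divide_le_eq)
  qed (use y_0 y_pos assms(5) in auto)
  define N where "N = (\<lambda>L. nat \<lfloor>\<rho> * real L\<rfloor>)"
  have \<rho>: "0 < \<rho>" "\<rho> < 1" using assms(7) by auto
  note A = floor_density_asymptotics[OF \<rho> N_def]
  have N1: "\<forall>\<^sub>F L in sequentially. N L \<ge> 1" using A(1) by (simp add: filterlim_at_top)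
  have NL: "\<forall>\<^sub>F L in sequentially. N L < L"
    using eventually_ge_at_top[of 1] by eventually_elim (rule A(5))
  have M1: "\<forall>\<^sub>F L in sequentially. L - N L \<ge> 1" using NL by eventually_elim simp
  have "1 / \<rho> - 1 > 0" using \<rho> by simp
  from current_ratio_limit[OF A(1) M1 A(3,4) this]
  have "(\<lambda>L. w * (N L / L) * ((P ^ N L) $ (L - N L - 1) / (P ^ N L) $ (L - N L)))
    \<longlonglongrightarrow> w * \<rho> * (if rho_crit y \<le> \<rho> then fugacity y (1 / \<rho> - 1) else fugacity y (1 / rho_crit y - 1))"
    unfolding current_density_fugacity[OF \<rho>] by (intro tendsto_intros A(2))
  \<comment> \<open>The formula for the current requires \<open>1 \<le> N L\<close> and
    \<open>N L < L\<close>, which fail only for finitely many \<open>L\<close>.\<close>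
  moreover have "\<forall>\<^sub>F L in sequentially. w * (N L / L) * ((P ^ N L) $ (L - N L - 1) / (P ^ N L) $ (L - N L))
      = stationary_current (tahep_rate w J) y L (N L)"
    using N1 NL
  proof eventually_elim
    case (elim L)
    have "stationary_current (tahep_rate w J) y L (N L)
      = w * (N L / L) * ((P ^ N L) $ (L - N L - 1) / (P ^ N L) $ (L - N L))"
      unfolding P_def
      by (rule stationary_current_eq[where y = y and w = w, OF y_0 y_pos _ elim])
        (use tahep_rate_eq[OF assms(2)] in \<open>simp_all add: assms(3)\<close>)
    then show ?case ..
  qed
  ultimately have "(\<lambda>L. stationary_current (tahep_rate w J) y L (N L))
    \<longlonglongrightarrow> w * \<rho> * (if rho_crit y \<le> \<rho> then fugacity y (1 / \<rho> - 1) else fugacity y (1 / rho_crit y - 1))"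
    by (rule Lim_transform_eventually)
  then show ?thesis unfolding N_def by (simp add: if_distrib)
qed
end
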